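(* Let $n\geq 3$ be an integer and let $k$ be a positive integer with $k\leq n-1$. Then the Praeger-Xu graph $\mathrm{PX}(n,k)$ is a Cayley graph if, and only if, the polynomial $t^n+1$ has a divisor of degree $n-k$ in $\mathbb{Z}_2[t]$.
   Context: For integers $n\geq 3$ and $1\leq k\leq n-1$, the Praeger-Xu graph $\mathrm{PX}(n,k)$ is the finite simple undirected graph with vertex set $\mathbb{Z}_n\times \mathbb{Z}_2^k$ (so it has $n2^k$ vertices), in which, for every $i\in\mathbb{Z}_n$ and all $x_0,x_1,\ldots,x_{k}\in\mathbb{Z}_2$, the vertex $(i,(x_0,x_1,\ldots,x_{k-1}))$ is adjacent to the vertex $(i+1,(x_1,\ldots,x_{k-1},x_k))$, and there are no other adjacencies. (For $k=1$ this means that $(i,x)$ is adjacent to $(i+1,y)$ for all $i\in\mathbb{Z}_n$ and $x,y\in\mathbb{Z}_2$.) A graph is a Cayley graph if it is isomorphic to $\mathrm{Cay}(G,S)$ for some group $G$ and some subset $S\subseteq G\setminus\{1\}$ with $S=S^{-1}$, where $\mathrm{Cay}(G,S)$ has vertex set $G$ and $g$ is adjacent to $h$ exactly when $hg^{-1}\in S$; equivalently, its automorphism group contains a subgroup acting regularly on the vertices. Here $\mathbb{Z}_2$ denotes the field with two elements. *)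

theory Defs
  imports
    "HOL-Library.Z2"
    "HOL-Computational_Algebra.Polynomial"
    "HOL-Algebra.Weak_Morphisms"
    "Graph_Theory.Graph_Theory"
begin

text \<open>
  Simple graphs are rendered as symmetric, loop-free \<^typ>\<open>'a pair_pre_digraph\<close>s (locale
  \<^locale>\<open>pair_graph\<close>): an edge between \<open>u\<close> and \<open>v\<close> is the pair of arcs \<open>(u, v)\<close>, \<open>(v, u)\<close>.
\<close>

lemma digraph_iso_with_proj_iff:
  assumes "pair_wf_digraph G" "pair_wf_digraph H"
  shows "digraph_iso (with_proj G) (with_proj H) \<longleftrightarrow>
    (\<exists>f. bij_betw f (pverts G) (pverts H) \<and>
      (\<forall>u\<in>pverts G. \<forall>v\<in>pverts G. (u, v) \<in> parcs G \<longleftrightarrow> (f u, f v) \<in> parcs H))"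
    (is "?L \<longleftrightarrow> ?R")
proof
  interpret G: pair_wf_digraph G by fact
  assume ?L
  then obtain h where h: "pre_digraph.digraph_isomorphism (with_proj G) h"
      and H: "with_proj H = app_iso h (with_proj G)"
    unfolding digraph_iso_def by blast
  have V: "pverts H = iso_verts h ` pverts G" and A: "parcs H = iso_arcs h ` parcs G"
    and T: "iso_tail h = fst" and D: "iso_head h = snd"
    using H by (simp_all add: app_iso_def with_proj_def)
  have inj: "inj_on (iso_verts h) (pverts G)"
    and arc: "\<And>a. a \<in> parcs G \<Longrightarrow>
      iso_arcs h a = (iso_verts h (fst a), iso_verts h (snd a))"
    using h by (auto simp: pre_digraph.digraph_isomorphism_def with_proj_def T D intro: prod_eqI)
  have "(u, v) \<in> parcs G \<longleftrightarrow> (iso_verts h u, iso_verts h v) \<in> parcs H"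
    if "u \<in> pverts G" "v \<in> pverts G" for u v
  proof
    assume "(u, v) \<in> parcs G"
    then show "(iso_verts h u, iso_verts h v) \<in> parcs H"
      using arc[of "(u, v)"] A by force
  next
    assume "(iso_verts h u, iso_verts h v) \<in> parcs H"
    then obtain a where a: "a \<in> parcs G" "iso_arcs h a = (iso_verts h u, iso_verts h v)"
      using A by auto
    then have "fst a = u" "snd a = v"
      using arc[OF a(1)] that inj G.arc_fst_in_verts[OF a(1)] G.arc_snd_in_verts[OF a(1)]
      by (auto dest: inj_onD)
    then show "(u, v) \<in> parcs G" using a(1) by (metis prod.collapse)
  qed
  then show ?R using V inj by (auto simp: bij_betw_def)
next
  interpret G: pair_wf_digraph G by fact
  interpret H: pair_wf_digraph H by fact
  assume ?R
  then obtain f where f: "bij_betw f (pverts G) (pverts H)"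
    and e: "\<And>u v. u \<in> pverts G \<Longrightarrow> v \<in> pverts G \<Longrightarrow>
      (u, v) \<in> parcs G \<longleftrightarrow> (f u, f v) \<in> parcs H" by blast
  define h where "h = \<lparr>iso_verts = f, iso_arcs = map_prod f f, iso_head = snd, iso_tail = fst\<rparr>"
  have A: "parcs H = map_prod f f ` parcs G"
  proof (intro equalityI subsetI)
    fix a assume a: "a \<in> parcs H"
    then have "fst a \<in> f ` pverts G" "snd a \<in> f ` pverts G"
      using f H.arc_fst_in_verts[OF a] H.arc_snd_in_verts[OF a] by (auto simp: bij_betw_def)
    then obtain u v where "u \<in> pverts G" "v \<in> pverts G" "a = (f u, f v)"
      by (metis imageE prod.collapse)
    then show "a \<in> map_prod f f ` parcs G" using e[of u v] a by force
  next
    fix a assume "a \<in> map_prod f f ` parcs G"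
    then obtain u v where uv: "(u, v) \<in> parcs G" "a = (f u, f v)" by auto
    then show "a \<in> parcs H"
      using e[of u v] G.arc_fst_in_verts[OF uv(1)] G.arc_snd_in_verts[OF uv(1)] by simp
  qed
  have inj: "inj_on (map_prod f f) (parcs G)"
  proof (rule inj_onI)
    fix a b assume ab: "a \<in> parcs G" "b \<in> parcs G" "map_prod f f a = map_prod f f b"
    then have "f (fst a) = f (fst b)" "f (snd a) = f (snd b)"
      by (metis fst_map_prod, metis snd_map_prod)
    then show "a = b"
      using f G.arc_fst_in_verts[OF ab(1)] G.arc_snd_in_verts[OF ab(1)]
        G.arc_fst_in_verts[OF ab(2)] G.arc_snd_in_verts[OF ab(2)]
      by (auto simp: bij_betw_def dest: inj_onD intro: prod_eqI)
  qed
  have "pre_digraph.digraph_isomorphism (with_proj G) h"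
    using inj f G.wf_digraph_axioms
    by (auto simp: pre_digraph.digraph_isomorphism_def h_def with_proj_def bij_betw_def)
  moreover have "with_proj H = app_iso h (with_proj G)"
    using f by (simp add: app_iso_def h_def with_proj_def A bij_betw_def)
  ultimately show ?L unfolding digraph_iso_def by blast
qed

definition Cay :: "('g, 'm) monoid_scheme \<Rightarrow> 'g set \<Rightarrow> 'g pair_pre_digraph" where
  "Cay G S = \<lparr> pverts = carrier G,
     parcs = {(g, h). g \<in> carrier G \<and> h \<in> carrier G \<and> h \<otimes>\<^bsub>G\<^esub> inv\<^bsub>G\<^esub> g \<in> S} \<rparr>"

definition connection_set :: "('g, 'm) monoid_scheme \<Rightarrow> 'g set \<Rightarrow> bool" where
  "connection_set G S \<longleftrightarrow> S \<subseteq> carrier G - {\<one>\<^bsub>G\<^esub>} \<and> S = m_inv G ` S"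

text \<open>
  HOL cannot quantify over types inside a formula, so the group is required to live on the vertex
  type. This is no restriction: by \<open>cayley_graphI\<close> below, an isomorphism with a Cayley graph of a
  group over any other type also suffices.
\<close>

definition cayley_graph :: "'a pair_pre_digraph \<Rightarrow> bool" where
  "cayley_graph \<Gamma> \<longleftrightarrow> (\<exists>(G :: 'a monoid) S. group G \<and> connection_set G S \<and>
     digraph_iso (with_proj \<Gamma>) (with_proj (Cay G S)))"

lemma pair_wf_digraph_Cay: "pair_wf_digraph (Cay G S)"
  by unfold_locales (auto simp: Cay_def)

lemma cayley_graphI:
  fixes \<Gamma> :: "'a pair_pre_digraph" and G :: "('g, 'm) monoid_scheme"
  assumes wf: "pair_wf_digraph \<Gamma>" and G: "group G" and S: "connection_set G S"
    and iso: "digraph_iso (with_proj \<Gamma>) (with_proj (Cay G S))"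
  shows "cayley_graph \<Gamma>"
proof -
  interpret G: group G by fact
  obtain f where f: "bij_betw f (pverts \<Gamma>) (carrier G)"
    using iso unfolding digraph_iso_with_proj_iff[OF wf pair_wf_digraph_Cay]
    by (auto simp: Cay_def)
  define g where "g = inv_into (pverts \<Gamma>) f"
  define H where "H = image_group g G"
  have g: "inj_on g (carrier G)"
    using f unfolding g_def by (metis bij_betw_def bij_betw_inv_into)
  have cH: "carrier H = g ` carrier G"
    by (simp add: H_def image_group_def)
  have mH: "g x \<otimes>\<^bsub>H\<^esub> g y = g (x \<otimes>\<^bsub>G\<^esub> y)" if "x \<in> carrier G" "y \<in> carrier G" for x y
    using that g by (simp add: H_def image_group_def)
  have oH: "\<one>\<^bsub>H\<^esub> = g \<one>\<^bsub>G\<^esub>"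
    by (simp add: H_def image_group_def)
  have grp: "group H"
  proof (rule groupI)
    fix x assume "x \<in> carrier H"
    then obtain a where a: "a \<in> carrier G" "x = g a" by (auto simp: cH)
    then have "inv\<^bsub>G\<^esub> a \<in> carrier G" "g (inv\<^bsub>G\<^esub> a) \<otimes>\<^bsub>H\<^esub> x = \<one>\<^bsub>H\<^esub>"
      by (simp_all add: mH oH)
    then show "\<exists>y\<in>carrier H. y \<otimes>\<^bsub>H\<^esub> x = \<one>\<^bsub>H\<^esub>" by (auto simp: cH)
  qed (auto simp: cH mH oH G.m_assoc)
  interpret H: group H by (rule grp)
  have iH: "inv\<^bsub>H\<^esub> (g x) = g (inv\<^bsub>G\<^esub> x)" if "x \<in> carrier G" for x
    using that by (intro H.inv_equality) (auto simp: cH mH oH)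
  have Sc: "S \<subseteq> carrier G" using S by (auto simp: connection_set_def)
  have "m_inv H ` (g ` S) = g ` (m_inv G ` S)"
    unfolding image_image using Sc iH by (intro image_cong) auto
  then have "connection_set H (g ` S)"
    using S g by (auto simp: connection_set_def cH oH dest: inj_onD)
  moreover have "digraph_iso (with_proj (Cay G S)) (with_proj (Cay H (g ` S)))"
    unfolding digraph_iso_with_proj_iff[OF pair_wf_digraph_Cay pair_wf_digraph_Cay]
  proof (intro exI[of _ g] conjI ballI)
    show "bij_betw g (pverts (Cay G S)) (pverts (Cay H (g ` S)))"
      using g by (simp add: Cay_def cH bij_betw_def)
    fix u v assume "u \<in> pverts (Cay G S)" "v \<in> pverts (Cay G S)"
    then have uv: "u \<in> carrier G" "v \<in> carrier G" by (simp_all add: Cay_def)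
    then have "g (v \<otimes>\<^bsub>G\<^esub> inv\<^bsub>G\<^esub> u) \<in> g ` S \<longleftrightarrow> v \<otimes>\<^bsub>G\<^esub> inv\<^bsub>G\<^esub> u \<in> S"
      using Sc by (intro inj_on_image_mem_iff[OF g]) auto
    then show "(u, v) \<in> parcs (Cay G S) \<longleftrightarrow> (g u, g v) \<in> parcs (Cay H (g ` S))"
      using uv by (simp add: Cay_def cH iH mH)
  qed
  ultimately show ?thesis
    using grp digraph_iso_trans[OF iso] unfolding cayley_graph_def by blast
qed

text \<open>
  \<open>\<int>\<^sub>n\<close> is \<^term>\<open>{..<n}\<close> with addition modulo \<open>n\<close>, and \<open>(\<int>\<^sub>2)\<^sup>k\<close> is the set of lists of length \<open>k\<close>
  over the two-element field \<^typ>\<open>bit\<close>. Below, \<open>x\<close> is the list \<open>[x\<^sub>0, \<dots>, x\<^sub>k]\<close>.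
\<close>

definition PX :: "nat \<Rightarrow> nat \<Rightarrow> (nat \<times> bit list) pair_pre_digraph" where
  "PX n k =
     (let A = {((i, butlast x), ((i + 1) mod n, tl x)) | i x. i < n \<and> length x = k + 1}
      in \<lparr> pverts = {..<n} \<times> {x. length x = k}, parcs = A \<union> A\<inverse> \<rparr>)"

lemma finite_UNIV_bit: "finite (UNIV :: bit set)" and card_UNIV_bit: "card (UNIV :: bit set) = 2"
proof -
  have *: "(UNIV :: bit set) = {0, 1}" by auto
  show "finite (UNIV :: bit set)" "card (UNIV :: bit set) = 2" unfolding * by simp_all
qed

lemma pair_graph_PX:
  assumes "n \<ge> 2"
  shows "pair_graph (PX n k)"
proof -
  have fin: "finite (pverts (PX n k))"
    using finite_lists_length_eq[of "UNIV :: bit set" k]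
    by (simp add: PX_def Let_def finite_UNIV_bit)
  have sub: "parcs (PX n k) \<subseteq> pverts (PX n k) \<times> pverts (PX n k)"
    using assms by (auto simp: PX_def Let_def)
  have loop: "(i + 1) mod n \<noteq> i" if "i < n" for i
    using assms that by (cases "i + 1 < n") (auto simp: not_less dest: le_antisym)
  show ?thesis
  proof unfold_locales
    show "finite (parcs (PX n k))"
      using sub fin by (meson finite_SigmaI finite_subset)
    show "symmetric (with_proj (PX n k))"
      unfolding symmetric_def by (auto simp: PX_def Let_def sym_def)
    show "fst e \<noteq> snd e" if "e \<in> parcs (PX n k)" for e
      using that loop by (fastforce simp: PX_def Let_def)
  qed (use sub fin in \<open>auto simp: mem_Times_iff\<close>)
qed

lemma card_verts_PX: "card (pverts (PX n k)) = n * 2 ^ k"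
  using card_lists_length_eq[of "UNIV :: bit set" k]
  by (simp add: PX_def Let_def card_cartesian_product finite_UNIV_bit card_UNIV_bit)

end

theory Submission
  imports Defs
begin

text \<open>
  Read the vertices of \<open>PX(n, k)\<close> as pairs of \<open>i \<in> \<int>\<^sub>n\<close> and the window \<open>[i, i + k)\<close> of an \<open>n\<close>-periodic
  sequence \<open>u\<close> over \<open>\<int>\<^sub>2\<close>; moving along an edge slides the window by one. Divisors of \<open>t ^ n + 1\<close> of
  degree \<open>n - k\<close> are generators of cyclic codes of dimension \<open>k\<close>. Such a code has any \<open>k\<close> consecutive
  coordinates as an information set, so that its translations together with the rotations act
  regularly on the vertices.

  For the converse, the divisor exists anyway if \<open>k = 1\<close> or \<open>n = 4\<close>. Otherwise the short cycles show
  that an automorphism preserves or reverses the orientation by \<open>i\<close>, and hence has the form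
  \<open>u \<mapsto> (\<lambda>p. u (p - r) + c p)\<close> or \<open>u \<mapsto> (\<lambda>p. u (q - p) + c p)\<close>. In a regular group the translations
  form a code \<open>K\<close>. If no reflection of the group fixes a fibre, then \<open>K\<close> has \<open>2 ^ k\<close> elements and is
  invariant under the rotation by \<open>2\<close>; otherwise it has \<open>2 ^ (k - 1)\<close> elements and is invariant under
  the rotation by \<open>1\<close>, and freeness of the action provides a class modulo \<open>K\<close> by which \<open>K\<close> can be
  enlarged. Finally, a code of dimension \<open>k\<close> invariant under the rotation by \<open>2\<close> yields the divisor,
  because the characteristic polynomial of that rotation on all \<open>n\<close>-periodic sequences is also
  \<open>t ^ n + 1\<close>.
\<close>

section \<open>Cyclic codes and divisors of \<open>t ^ n + 1\<close>\<close>

text \<open>This rule rewrites sums of bits to \<open>XOR\<close> and then to formulas, defeating ring normalisation.\<close>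

declare add_bit_eq_xor [simp del]

lemma bit_add_self [simp]: "a + a = (0 :: bit)"
  by (cases a rule: bit.exhaust) simp_all

lemma bit_add_left_self [simp]: "a + (a + b) = (b :: bit)"
  by (cases a rule: bit.exhaust; cases b rule: bit.exhaust) simp_all

lemma bit_add_cancel [simp]: "a + b + a = (b :: bit)"
  by (cases a rule: bit.exhaust; cases b rule: bit.exhaust) simp_all

lemma bit_add_eq_0_iff: "a + b = 0 \<longleftrightarrow> a = (b :: bit)"
  by (metis add.right_neutral bit_add_left_self bit_add_self)

lemma bit_poly_add_self [simp]: "p + p = (0 :: bit poly)"
  by (rule poly_eqI) (simp only: coeff_add bit_add_self coeff_0)

lemma bit_poly_diff_eq_add: "p - q = p + (q :: bit poly)"
  by (metis add_diff_cancel_right' add.assoc add.right_neutral bit_poly_add_self)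

text \<open>Words with cyclic indices, kept as functions on all integers so that shifts and
  reflections compose without reducing indices.\<close>

definition cyclic_seqs :: "nat \<Rightarrow> (int \<Rightarrow> bit) set" where
  "cyclic_seqs n = {c. \<forall>j. c (j + int n) = c j}"

text \<open>Over the two-element field every element is its own negative, so these are exactly the
  linear subspaces.\<close>

definition add_subgroup :: "(int \<Rightarrow> bit) set \<Rightarrow> bool" where
  "add_subgroup K \<longleftrightarrow> (\<lambda>_. 0) \<in> K \<and> (\<forall>c\<in>K. \<forall>d\<in>K. (\<lambda>j. c j + d j) \<in> K)"

lemma cyclic_seqs_shift_mult: "c \<in> cyclic_seqs n \<Longrightarrow> c (j + int n * m) = c j"
proof (induction m rule: int_induct[where k = 0])
  case (step1 m)
  then have "c (j + int n * (m + 1)) = c ((j + int n * m) + int n)" by (simp add: algebra_simps)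
  then show ?case using step1 by (simp add: cyclic_seqs_def)
next
  case (step2 m)
  then have "c ((j + int n * (m - 1)) + int n) = c (j + int n * (m - 1))"
    by (simp only: cyclic_seqs_def mem_Collect_eq)
  then show ?case using step2 by (simp add: algebra_simps)
qed simp

lemma cyclic_seqs_cong:
  assumes "c \<in> cyclic_seqs n" "i mod int n = j mod int n"
  shows "c i = c j"
proof -
  have "int n dvd i - j" using assms(2) by (simp add: mod_eq_dvd_iff)
  then obtain m where "i - j = int n * m" by (rule dvdE)
  then have "i = j + int n * m" by simp
  then show ?thesis using cyclic_seqs_shift_mult[OF assms(1)] by simp
qed

section \<open>Residues modulo \<open>t ^ n + 1\<close> as periodic sequences\<close>

definition cyc_poly :: "nat \<Rightarrow> bit poly" where "cyc_poly n = monom 1 n + 1"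

lemma degree_cyc_poly: "n > 0 \<Longrightarrow> degree (cyc_poly n) = n"
  unfolding cyc_poly_def by (subst degree_add_eq_left) (auto simp: degree_monom_eq)

lemma coeff_cyc_poly: "n > 0 \<Longrightarrow> coeff (cyc_poly n) i = (if i = n \<or> i = 0 then 1 else 0)"
  by (auto simp: cyc_poly_def)

lemma cyc_poly_nz: "n > 0 \<Longrightarrow> cyc_poly n \<noteq> 0"
  using degree_cyc_poly[of n] by auto

lemma coeff_eq_0_mod_cyc_poly: "n > 0 \<Longrightarrow> i \<ge> n \<Longrightarrow> coeff (p mod cyc_poly n) i = 0"
  using degree_mod_less[of "cyc_poly n" p] cyc_poly_nz[of n] degree_cyc_poly[of n]
  by (auto simp: coeff_eq_0)

lemma mod_cyc_poly_id: "n > 0 \<Longrightarrow> \<forall>i\<ge>n. coeff p i = 0 \<Longrightarrow> p mod cyc_poly n = p"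
proof (cases "p = 0")
  case False
  assume "n > 0" "\<forall>i\<ge>n. coeff p i = 0"
  then have "degree p < degree (cyc_poly n)"
    using False leading_coeff_0_iff[of p] by (metis degree_cyc_poly linorder_not_le)
  then show ?thesis by (rule mod_poly_less)
qed simp

definition seq_of_poly :: "nat \<Rightarrow> bit poly \<Rightarrow> int \<Rightarrow> bit" where
  "seq_of_poly n p j = coeff (p mod cyc_poly n) (nat (j mod int n))"

lemma seq_of_poly_in: "seq_of_poly n p \<in> cyclic_seqs n"
  by (simp add: seq_of_poly_def cyclic_seqs_def)

lemma seq_of_poly_add: "seq_of_poly n (p + q) = (\<lambda>j. seq_of_poly n p j + seq_of_poly n q j)"
  by (simp add: seq_of_poly_def poly_mod_add_left fun_eq_iff)

lemma seq_of_poly_0 [simp]: "seq_of_poly n 0 = (\<lambda>_. 0)"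
  by (simp add: seq_of_poly_def fun_eq_iff)

text \<open>Multiplication by \<open>t\<close> becomes the rotation by one, because the coefficient
  that overflows into degree \<open>n\<close> wraps around to the constant term.\<close>

lemma seq_of_poly_pCons_0:
  assumes "n > 0"
  shows "seq_of_poly n (pCons 0 p) = (\<lambda>j. seq_of_poly n p (j - 1))"
proof
  fix j :: int
  define r where "r = p mod cyc_poly n"
  define m where "m = nat (j mod int n)"
  have m: "m < n" "int m = j mod int n" using assms by (simp_all add: m_def nat_less_iff)
  \<comment> \<open>The modulus is monic, so subtracting one scalar multiple of it reduces
    \<open>t\<close> times a reduced polynomial.\<close>
  have "lead_coeff (cyc_poly n) = 1" using assms by (simp add: degree_cyc_poly coeff_cyc_poly)
  then have e: "pCons 0 p mod cyc_poly n = pCons 0 r - smult (coeff (pCons 0 r) n) (cyc_poly n)"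
    using assms by (simp add: mod_pCons[OF cyc_poly_nz] Let_def degree_cyc_poly r_def)
  have "seq_of_poly n (pCons 0 p) j
    = coeff (pCons 0 r - smult (coeff (pCons 0 r) n) (cyc_poly n)) m"
    by (simp add: seq_of_poly_def e m_def)
  also have "\<dots> = coeff r (nat ((j - 1) mod int n))"
  proof (cases m)
    case 0
    then have "(j - 1) mod int n = int n - 1"
      using m(2) assms by (metis int_ops(1) mod_diff_left_eq diff_0 zmod_minus1 of_nat_0_less_iff)
    then have "nat ((j - 1) mod int n) = n - 1" by simp
    then show ?thesis using 0 assms by (simp add: coeff_cyc_poly coeff_pCons split: nat.split)
  next
    case (Suc l)
    have "(j - 1) mod int n = (int m - 1) mod int n" using m(2) by (simp add: mod_diff_left_eq)
    also have "\<dots> = int l" using Suc m(1) by simp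
    finally have "nat ((j - 1) mod int n) = l" by simp
    then show ?thesis using Suc m(1) assms by (simp add: coeff_cyc_poly)
  qed
  finally show "seq_of_poly n (pCons 0 p) j = seq_of_poly n p (j - 1)"
    by (simp add: seq_of_poly_def r_def)
qed

lemma seq_of_poly_surj:
  assumes "n > 0" "c \<in> cyclic_seqs n"
  obtains p where "\<forall>i\<ge>n. coeff p i = 0" "seq_of_poly n p = c"
proof -
  define p where "p = Poly (map (\<lambda>i. c (int i)) [0..<n])"
  have cp: "coeff p i = (if i < n then c (int i) else 0)" for i
    by (simp add: p_def nth_default_def)
  have "seq_of_poly n p j = c j" for j
  proof -
    have "c (j mod int n) = c j" using assms by (intro cyclic_seqs_cong[OF assms(2)]) simp
    then show ?thesis
      using assms(1) mod_cyc_poly_id[OF assms(1), of p] cp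
        by (simp add: seq_of_poly_def nat_less_iff)
  qed
  then show ?thesis using cp by (intro that[of p]) auto
qed

text \<open>With additivity this gives injectivity on reduced polynomials, which equal their own
  residues.\<close>

lemma seq_of_poly_eq_0:
  assumes "n > 0" "\<forall>i\<ge>n. coeff p i = 0" "\<forall>j. seq_of_poly n p j = 0"
  shows "p = 0"
proof (rule poly_eqI)
  fix i show "coeff p i = coeff 0 i"
  proof (cases "i < n")
    case True
    then show ?thesis
      using assms(3)[rule_format, of "int i"] mod_cyc_poly_id[OF assms(1,2)]
        by (simp add: seq_of_poly_def)
  qed (use assms(2) in auto)
qed

text \<open>Splitting off the constant coefficient doubles the count. Bounding coefficients instead
  of the degree keeps the zero polynomial in for \<open>m = 0\<close>.\<close>

lemma card_poly_bounded: "finite {p :: bit poly. \<forall>i\<ge>m. coeff p i = 0}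
  \<and> card {p :: bit poly. \<forall>i\<ge>m. coeff p i = 0} = 2 ^ m"
proof (induction m)
  case 0
  have "{p :: bit poly. \<forall>i\<ge>0. coeff p i = 0} = {0}" by (auto intro: poly_eqI)
  then show ?case by simp
next
  case (Suc m)
  let ?A = "\<lambda>m. {p :: bit poly. \<forall>i\<ge>m. coeff p i = 0}"
  have "?A (Suc m) = (\<lambda>(a, p). pCons a p) ` (UNIV \<times> ?A m)"
  proof (intro equalityI subsetI)
    fix p assume p: "p \<in> ?A (Suc m)"
    obtain a q where pq: "p = pCons a q" by (metis pCons_cases)
    have "coeff q i = 0" if "i \<ge> m" for i
      using p that pq by (auto dest: spec[of _ "Suc i"])
    then show "p \<in> (\<lambda>(a, p). pCons a p) ` (UNIV \<times> ?A m)" using pq by force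
  qed (auto simp: coeff_pCons split: nat.split)
  moreover have "inj_on (\<lambda>(a, p). pCons a p) (UNIV \<times> ?A m)"
    by (auto intro: inj_onI)
  ultimately show ?case
    using Suc by (simp add: card_image card_cartesian_product finite_UNIV_bit card_UNIV_bit)
qed

lemma finite_cyclic_seqs: "n > 0 \<Longrightarrow> finite (cyclic_seqs n)"
proof -
  assume n: "n > 0"
  have "cyclic_seqs n \<subseteq> seq_of_poly n ` {p. \<forall>i\<ge>n. coeff p i = 0}"
  proof
    fix c assume "c \<in> cyclic_seqs n"
    then obtain p where "\<forall>i\<ge>n. coeff p i = 0" "seq_of_poly n p = c" by (rule seq_of_poly_surj[OF n])
    then show "c \<in> seq_of_poly n ` {p. \<forall>i\<ge>n. coeff p i = 0}" by auto
  qed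
  then show ?thesis using card_poly_bounded finite_surj by blast
qed

section \<open>Cyclic codes and their generator polynomials\<close>

definition code_of :: "nat \<Rightarrow> bit poly \<Rightarrow> (int \<Rightarrow> bit) set" where
  "code_of n g = {seq_of_poly n p | p. g dvd p}"

lemma code_of_subset: "code_of n g \<subseteq> cyclic_seqs n"
  using seq_of_poly_in by (auto simp: code_of_def)

lemma add_subgroup_code_of: "add_subgroup (code_of n g)"
  unfolding add_subgroup_def code_of_def
proof (intro conjI ballI)
  show "(\<lambda>_. 0) \<in> {seq_of_poly n p |p. g dvd p}"
    using seq_of_poly_0[of n, symmetric] dvd_0_right[of g] by blast
next
  fix c d assume "c \<in> {seq_of_poly n p |p. g dvd p}" "d \<in> {seq_of_poly n p |p. g dvd p}"
  then obtain p q where "g dvd p" "g dvd q" "c = seq_of_poly n p" "d = seq_of_poly n q" by blast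
  then have "g dvd p + q" "(\<lambda>j. c j + d j) = seq_of_poly n (p + q)"
    by (simp_all add: seq_of_poly_add)
  then show "(\<lambda>j. c j + d j) \<in> {seq_of_poly n p |p. g dvd p}" by blast
qed

lemma code_of_shift:
  assumes "n > 0" "c \<in> code_of n g"
  shows "(\<lambda>j. c (j - 1)) \<in> code_of n g"
proof -
  obtain p where p: "g dvd p" "c = seq_of_poly n p" using assms(2) by (auto simp: code_of_def)
  have "pCons 0 p = p * [:0, 1:]" by simp
  then have "g dvd pCons 0 p" using p(1) by (metis dvd_mult2)
  then show ?thesis using p(2) seq_of_poly_pCons_0[OF assms(1), of p, symmetric]
    unfolding code_of_def by blast
qed

text \<open>As \<open>g\<close> divides the modulus, the residue of a multiple of \<open>g\<close>
  is again a multiple of \<open>g\<close>.\<close>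

lemma code_of_reduced:
  assumes "n > 0" "g dvd cyc_poly n" "c \<in> code_of n g"
  obtains p where "g dvd p" "\<forall>i\<ge>n. coeff p i = 0" "c = seq_of_poly n p"
proof -
  obtain p where p: "g dvd p" "c = seq_of_poly n p" using assms(3) by (auto simp: code_of_def)
  show ?thesis
    using assms p by (intro that[of "p mod cyc_poly n"])
      (auto simp: dvd_mod coeff_eq_0_mod_cyc_poly seq_of_poly_def fun_eq_iff)
qed

text \<open>The codewords correspond to the reduced products \<open>q * g\<close>, one for each
  \<open>q\<close> with coefficients only below \<open>n - degree g\<close>.\<close>

lemma card_code_of:
  assumes n: "n > 0" and g: "g dvd cyc_poly n"
  shows "card (code_of n g) = 2 ^ (n - degree g)"
proof -
  let ?A = "\<lambda>m. {p :: bit poly. \<forall>i\<ge>m. coeff p i = 0}"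
  let ?f = "\<lambda>q. seq_of_poly n (q * g)"
  have gz: "g \<noteq> 0" using g cyc_poly_nz[OF n] by auto
  have dg: "degree g \<le> n" using dvd_imp_degree_le[OF g cyc_poly_nz[OF n]] degree_cyc_poly[OF n]
    by simp
  have mA: "p \<in> ?A m \<longleftrightarrow> p = 0 \<or> degree p < m" for p :: "bit poly" and m
    by (auto simp: coeff_eq_0) (meson leading_coeff_0_iff not_le_imp_less)
  have mult: "q * g \<in> ?A n \<longleftrightarrow> q \<in> ?A (n - degree g)" for q
    unfolding mA using gz dg by (cases "q = 0") (auto simp: degree_mult_eq)
  have "inj_on ?f (?A (n - degree g))"
  proof (rule inj_onI)
    fix p q assume pq: "p \<in> ?A (n - degree g)" "q \<in> ?A (n - degree g)" "?f p = ?f q"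
    have "\<forall>j. seq_of_poly n ((p + q) * g) j = 0"
      using pq(3) by (simp add: distrib_right seq_of_poly_add)
    moreover have "(p + q) * g \<in> ?A n" unfolding mult using pq by auto
    ultimately have "(p + q) * g = 0" using seq_of_poly_eq_0[OF n] by blast
    then show "p = q" using gz
      by (metis add_diff_cancel_left' bit_poly_diff_eq_add diff_0_right mult_eq_0_iff
        eq_iff_diff_eq_0)
  qed
  moreover have "?f ` ?A (n - degree g) = code_of n g"
  proof (intro equalityI subsetI)
    fix c assume "c \<in> code_of n g"
    then obtain p where p: "g dvd p" "\<forall>i\<ge>n. coeff p i = 0" "c = seq_of_poly n p"
      by (rule code_of_reduced[OF n g])
    then obtain q where q: "p = q * g" by (metis dvd_div_mult_self)
    then have "q \<in> ?A (n - degree g)" using p(2) mult[of q] by blast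
    then show "c \<in> ?f ` ?A (n - degree g)" using p(3) q by blast
  next
    fix c assume "c \<in> ?f ` ?A (n - degree g)"
    then show "c \<in> code_of n g" unfolding code_of_def using dvd_triv_right by blast
  qed
  ultimately show ?thesis using card_poly_bounded[of "n - degree g"] card_image[of ?f "?A (n -
    degree g)"] by simp
qed

text \<open>After a rotation that brings the zero window into the top coefficients, the reduced
  polynomial is a multiple of \<open>g\<close> without coefficients from \<open>degree g\<close> on,
  hence zero.\<close>

lemma code_of_window_0:
  assumes n: "n > 0" and g: "g dvd cyc_poly n" and c: "c \<in> code_of n g"
    and z: "\<And>j. 0 \<le> j \<Longrightarrow> j < int (n - degree g) \<Longrightarrow> c (i + j) = 0"
  shows "c j = 0"
proof -
  have shift: "(\<lambda>j. c (j - int m)) \<in> code_of n g" for m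
  proof (induction m)
    case (Suc m)
    then show ?case using code_of_shift[OF n, of "\<lambda>j. c (j - int m)" g] by (simp add: algebra_simps)
  qed (use c in simp)
  define a where "a = i - int (degree g)"
  \<comment> \<open>\<open>shift\<close> rotates by natural numbers only, so \<open>- a\<close> is
    replaced by its representative modulo \<open>n\<close>.\<close>
  define m where "m = nat ((- a) mod int n)"
  have cs: "c \<in> cyclic_seqs n" using c code_of_subset by auto
  obtain p where p: "g dvd p" "\<forall>i\<ge>n. coeff p i = 0" "(\<lambda>j. c (j - int m)) = seq_of_poly n p"
    using code_of_reduced[OF n g shift] by metis
  have dg: "degree g \<le> n" using dvd_imp_degree_le[OF g cyc_poly_nz[OF n]] degree_cyc_poly[OF n]
    by simp
  have am: "c (l - int m) = c (l + a)" for l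
  proof (rule cyclic_seqs_cong[OF cs])
    have "int m = (- a) mod int n" using n by (simp add: m_def)
    then show "(l - int m) mod int n = (l + a) mod int n" by (simp add: mod_diff_right_eq)
  qed
  have "coeff p l = 0" if "l \<ge> degree g" for l
  proof (cases "l < n")
    case True
    then have "coeff p l = seq_of_poly n p (int l)"
      using mod_cyc_poly_id[OF n p(2)] by (simp add: seq_of_poly_def)
    also have "\<dots> = c (int l - int m)" using p(3) by (metis (no_types))
    also have "\<dots> = c (i + (int l - int (degree g)))" unfolding am a_def by (simp add: algebra_simps)
    also have "\<dots> = 0" using that True by (intro z) (auto simp: dg)
    finally show ?thesis .
  qed (use p(2) in auto)
  then have "p = 0" using p(1)
    by (metis dvd_imp_degree_le leading_coeff_0_iff)
  then have "seq_of_poly n p (j + int m) = 0" by simp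
  then show ?thesis unfolding p(3)[symmetric] by simp
qed

text \<open>The preimage \<open>I\<close> of \<open>K\<close> is an ideal, since multiplication by
  \<open>t\<close> is the rotation. A nonzero element of least degree generates it, and
  \<open>t ^ n + 1\<close> lies in it because it maps to zero.\<close>

lemma cyclic_code_generator:
  assumes n: "n > 0" and K: "K \<subseteq> cyclic_seqs n" "add_subgroup K"
    and sh: "\<And>c. c \<in> K \<Longrightarrow> (\<lambda>j. c (j - 1)) \<in> K"
  obtains g where "g dvd cyc_poly n" "card K = 2 ^ (n - degree g)"
proof -
  define I where "I = {p. seq_of_poly n p \<in> K}"
  have I0: "0 \<in> I" using K(2) by (simp add: I_def add_subgroup_def)
  have Iadd: "p + q \<in> I" if "p \<in> I" "q \<in> I" for p q
    using that K(2) by (simp add: I_def add_subgroup_def seq_of_poly_add)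
  have Imult: "q * p \<in> I" if "p \<in> I" for p q
  proof (induction q)
    case 0
    then show ?case using I0 by simp
  next
    case (pCons a q)
    then have "pCons 0 (q * p) \<in> I" using sh by (simp add: I_def seq_of_poly_pCons_0[OF n])
    moreover have "smult a p \<in> I" using that I0 by (cases a rule: bit.exhaust) auto
    ultimately show ?case using Iadd by simp
  qed
  have IM: "cyc_poly n \<in> I" using I0 by (simp add: I_def seq_of_poly_def[abs_def])
  obtain g where g: "g \<in> I" "g \<noteq> 0" and gmin: "\<And>p. p \<in> I \<Longrightarrow> p \<noteq> 0 \<Longrightarrow> degree g \<le> degree p"
    using ex_has_least_nat[of "\<lambda>p. p \<in> I \<and> p \<noteq> 0" "cyc_poly n" degree] IM cyc_poly_nz[OF n] by blast
  have gd: "g dvd p" if "p \<in> I" for p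
  proof (rule ccontr)
    assume "\<not> g dvd p"
    then have nz: "p mod g \<noteq> 0" by (simp add: dvd_eq_mod_eq_0)
    have "p mod g = p + (p div g) * g"
      by (metis bit_poly_diff_eq_add minus_div_mult_eq_mod)
    then have "p mod g \<in> I" using Iadd[OF that Imult[OF g(1)]] by simp
    then show False using gmin nz degree_mod_less[OF g(2), of p] by fastforce
  qed
  have "code_of n g = K"
  proof (intro equalityI subsetI)
    fix c assume "c \<in> code_of n g"
    then obtain p where "g dvd p" "c = seq_of_poly n p" by (auto simp: code_of_def)
    moreover from this have "p \<in> I" using Imult[OF g(1)] by (metis dvd_div_mult_self)
    ultimately show "c \<in> K" by (simp add: I_def)
  next
    fix c assume c: "c \<in> K"
    then have "c \<in> cyclic_seqs n" using K(1) by blast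
    then obtain p where p: "seq_of_poly n p = c" by (rule seq_of_poly_surj[OF n])
    then have "g dvd p" using c by (intro gd) (simp add: I_def)
    then show "c \<in> code_of n g" using p by (auto simp: code_of_def)
  qed
  then show ?thesis using card_code_of[OF n gd[OF IM]] gd[OF IM] that by metis
qed

section \<open>Codes invariant under the rotation by two\<close>

lemma card_hom_image_kernel:
  assumes fin: "finite K" and K: "add_subgroup K"
    and hom: "\<And>c d. f (\<lambda>j. c j + d j) = (\<lambda>j. f c j + f d j :: bit)"
  shows "card K = card (f ` K) * card {c \<in> K. f c = (\<lambda>_. 0)}"
proof -
  let ?N = "{c \<in> K. f c = (\<lambda>_. 0)}"
  have "card {x \<in> K. f x = y} = card ?N" if y: "y \<in> f ` K" for y
  proof -
    obtain c where c: "c \<in> K" "y = f c" using y by blast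
    \<comment> \<open>Each fibre of \<open>f\<close> is a coset of the kernel; translation by
      \<open>c\<close> is its own inverse.\<close>
    have "bij_betw (\<lambda>d j. c j + d j) ?N {x \<in> K. f x = y}"
    proof (intro bij_betwI[where g = "\<lambda>d j. c j + d j"])
      show "(\<lambda>d j. c j + d j) \<in> ?N \<rightarrow> {x \<in> K. f x = y}"
        using c K hom by (auto simp: add_subgroup_def)
      show "(\<lambda>d j. c j + d j) \<in> {x \<in> K. f x = y} \<rightarrow> ?N"
        using c K hom by (auto simp: add_subgroup_def)
    qed auto
    then show ?thesis by (simp add: bij_betw_same_card)
  qed
  then have "(\<Sum>y\<in>f ` K. card {x \<in> K. f x = y}) = card (f ` K) * card ?N" by simp
  then show ?thesis using sum.image_gen[OF fin, of "\<lambda>_. 1 :: nat" f] by simp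
qed

lemma cyc_poly_double: "cyc_poly m * cyc_poly m = cyc_poly (2 * m)"
proof -
  have "(monom 1 m + 1) * (monom 1 m + 1)
    = monom 1 m * monom 1 m + (monom 1 m + monom 1 m) + (1 :: bit poly)"
    by (simp only: distrib_left distrib_right mult_1_left mult_1_right add.assoc)
  then show ?thesis by (simp add: cyc_poly_def mult_monom mult_2)
qed

text \<open>
  For even \<open>n\<close>, the even and the odd coordinates of a \<open>2\<close>-quasicyclic code give two cyclic codes of
  length \<open>n div 2\<close>, and \<open>t ^ n + 1\<close> is the square of \<open>t ^ (n div 2) + 1\<close>.
\<close>

lemma quasicyclic_code_divisor:
  assumes n: "n > 0" and K: "K \<subseteq> cyclic_seqs n" "add_subgroup K"
    and sh: "\<And>c. c \<in> K \<Longrightarrow> (\<lambda>j. c (j - 2)) \<in> K"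
    and card: "card K = 2 ^ k"
  shows "\<exists>g. g dvd cyc_poly n \<and> degree g = n - k"
proof (cases "even n")
  case False
  then obtain m where m: "n = 2 * m + 1" by (metis oddE)
  have sh': "(\<lambda>j. c (j - 2 * int l)) \<in> K" if "c \<in> K" for c l
  proof (induction l)
    case (Suc l)
    then show ?case using sh[of "\<lambda>j. c (j - 2 * int l)"] by (simp add: algebra_simps)
  qed (use that in simp)
  have "(\<lambda>j. c (j - 1)) \<in> K" if c: "c \<in> K" for c
  proof -
    \<comment> \<open>\<open>2 * (m + 1) = n + 1\<close>, so \<open>m + 1\<close> rotations by two
      make one rotation by one.\<close>
    have "c (j - 2 * int (m + 1)) = c (j - 1)" for j
      using K(1) c m cyclic_seqs_shift_mult[of c n "j - 1" "-1"] by (auto simp: algebra_simps)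
    then show ?thesis using sh'[OF c, of "m + 1"] by simp
  qed
  then obtain g where g: "g dvd cyc_poly n" "card K = 2 ^ (n - degree g)"
    by (rule cyclic_code_generator[OF n K])
  then have "degree g \<le> n" using dvd_imp_degree_le[OF g(1) cyc_poly_nz[OF n]] degree_cyc_poly[OF n]
    by simp
  then show ?thesis using g card by (intro exI[of _ g]) auto
next
  case True
  then obtain m where m: "n = 2 * m" by (metis evenE)
  then have m0: "m > 0" using n by simp
  define f0 f1 :: "(int \<Rightarrow> bit) \<Rightarrow> int \<Rightarrow> bit" where "f0 = (\<lambda>c j. c (2 * j))"
    and "f1 = (\<lambda>c j. c (2 * j + 1))"
  \<comment> \<open>On the words with zero even coordinates \<open>f1\<close> is injective. So
    \<open>k\<close> is the sum of the dimensions of the images of \<open>K\<close> under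
    \<open>f0\<close> and of \<open>N\<close> under \<open>f1\<close>, and the degrees of their
    generators add up to \<open>n - k\<close>.\<close>
  define N where "N = {c \<in> K. f0 c = (\<lambda>_. 0)}"
  have fin: "finite K" using K(1) finite_cyclic_seqs[OF n] finite_subset by blast
  have c0: "card K = card (f0 ` K) * card N"
    unfolding N_def by (rule card_hom_image_kernel[OF fin K(2)]) (simp add: f0_def)
  have "inj_on f1 N"
  proof (rule inj_onI, rule ext)
    fix c d and j :: int assume a: "c \<in> N" "d \<in> N" "f1 c = f1 d"
    show "c j = d j"
    proof (cases "even j")
      case True
      then obtain i where "j = 2 * i" by (metis evenE)
      moreover have "f0 c i = 0" "f0 d i = 0" using a by (simp_all add: N_def)
      ultimately show ?thesis by (simp add: f0_def)
    next
      case False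
      then obtain i where "j = 2 * i + 1" by (metis oddE)
      then show ?thesis using fun_cong[OF a(3), of i] by (simp add: f1_def)
    qed
  qed
  then have c1: "card N = card (f1 ` N)" by (simp add: card_image)
  have cs: "f0 ` cyclic_seqs n \<subseteq> cyclic_seqs m" "f1 ` cyclic_seqs n \<subseteq> cyclic_seqs m"
  proof -
    have "f0 c (j + int m) = f0 c j \<and> f1 c (j + int m) = f1 c j" if "c \<in> cyclic_seqs n" for c j
      using that cyclic_seqs_cong[OF that, of "2 * (j + int m)" "2 * j"]
        cyclic_seqs_cong[OF that, of "2 * (j + int m) + 1" "2 * j + 1"]
      by (simp add: f0_def f1_def m mod_eq_dvd_iff algebra_simps)
    then show "f0 ` cyclic_seqs n \<subseteq> cyclic_seqs m" "f1 ` cyclic_seqs n \<subseteq> cyclic_seqs m"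
      by (auto simp: cyclic_seqs_def)
  qed
  have Nsub: "add_subgroup N" "N \<subseteq> K"
    using K(2) by (auto simp: N_def add_subgroup_def f0_def fun_eq_iff)
  have Nsh: "(\<lambda>j. c (j - 2)) \<in> N" if "c \<in> N" for c
  proof -
    have "f0 c (i - 1) = 0" for i using that by (simp add: N_def)
    then have "f0 (\<lambda>j. c (j - 2)) = (\<lambda>_. 0)" by (simp add: f0_def fun_eq_iff algebra_simps)
    then show ?thesis using that sh by (simp add: N_def)
  qed
  have f0i: "(\<lambda>j. c (j - 1)) \<in> f0 ` K" if "c \<in> f0 ` K" for c
  proof -
    obtain d where "d \<in> K" "c = f0 d" using \<open>c \<in> f0 ` K\<close> by auto
    then have "(\<lambda>j. c (j - 1)) = f0 (\<lambda>j. d (j - 2))" by (simp add: f0_def algebra_simps)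
    then show ?thesis using sh[OF \<open>d \<in> K\<close>] by auto
  qed
  have f1i: "(\<lambda>j. c (j - 1)) \<in> f1 ` N" if "c \<in> f1 ` N" for c
  proof -
    obtain d where "d \<in> N" "c = f1 d" using \<open>c \<in> f1 ` N\<close> by auto
    then have "(\<lambda>j. c (j - 1)) = f1 (\<lambda>j. d (j - 2))" by (simp add: f1_def algebra_simps)
    then show ?thesis using Nsh[OF \<open>d \<in> N\<close>] by auto
  qed
  have sub: "add_subgroup (h ` L)" if "add_subgroup L" "h = f0 \<or> h = f1" for h L
    using that unfolding add_subgroup_def f0_def f1_def image_iff by fastforce
  obtain g0 where g0: "g0 dvd cyc_poly m" "card (f0 ` K) = 2 ^ (m - degree g0)"
    by (rule cyclic_code_generator[OF m0 _ sub[OF K(2), of f0] f0i]) (use K(1) cs(1) in blast)+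
  obtain g1 where g1: "g1 dvd cyc_poly m" "card (f1 ` N) = 2 ^ (m - degree g1)"
    by (rule cyclic_code_generator[OF m0 _ sub[OF Nsub(1), of f1] f1i]) (use K(1) cs(2) Nsub(2) in
      blast)+
  have nz: "g0 \<noteq> 0" "g1 \<noteq> 0" using g0 g1 cyc_poly_nz[OF m0] by auto
  have le: "degree g0 \<le> m" "degree g1 \<le> m"
    using dvd_imp_degree_le[OF _ cyc_poly_nz[OF m0]] degree_cyc_poly[OF m0] g0 g1 by metis+
  have "2 ^ k = (2 :: nat) ^ ((m - degree g0) + (m - degree g1))"
    using card c0 c1 g0 g1 by (simp add: power_add)
  then have "k = (m - degree g0) + (m - degree g1)" by simp
  then have "degree (g0 * g1) = n - k" using le nz m by (simp add: degree_mult_eq)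
  moreover have "g0 * g1 dvd cyc_poly n" using mult_dvd_mono[OF g0(1) g1(1)]
    by (simp add: cyc_poly_double m)
  ultimately show ?thesis by blast
qed

text \<open>Settles \<open>k = 1\<close>: as 1 is a root, the cofactor of the linear factor is the
  divisor sought.\<close>

lemma cyc_poly_divisor_1:
  assumes n: "n > 0"
  shows "\<exists>g. g dvd cyc_poly n \<and> degree g = n - 1"
proof -
  have "poly (cyc_poly n) 1 = 0" by (simp add: cyc_poly_def poly_monom)
  then have "[:- 1, 1:] dvd cyc_poly n" by (simp only: poly_eq_0_iff_dvd)
  then obtain q where q: "cyc_poly n = [:- 1, 1:] * q" by (metis dvdE)
  then have "q \<noteq> 0" using cyc_poly_nz[OF n] by auto
  then have "n = 1 + degree q" using q degree_cyc_poly[OF n]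
    by (simp add: degree_mult_eq del: mult_pCons_left)
  then show ?thesis using q by (intro exI[of _ q]) (metis add_diff_cancel_left' dvd_triv_right)
qed

text \<open>Settles \<open>n = 4\<close>: \<open>t ^ 4 + 1\<close> is the fourth power of
  \<open>t + 1\<close>, whose powers have all degrees up to 4.\<close>

lemma cyc_poly_divisor_4:
  assumes "k \<le> 4"
  shows "\<exists>g. g dvd cyc_poly 4 \<and> degree g = 4 - k"
proof -
  have "cyc_poly 1 ^ 4 = (cyc_poly 1 * cyc_poly 1) * (cyc_poly 1 * cyc_poly 1)"
    by (simp add: power4_eq_xxxx mult.assoc)
  also have "\<dots> = cyc_poly 4" by (simp add: cyc_poly_double)
  finally have "cyc_poly 4 = cyc_poly 1 ^ 4" ..
  then have "cyc_poly 1 ^ (4 - k) dvd cyc_poly 4" by (simp add: le_imp_power_dvd)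
  moreover have "degree (cyc_poly 1 ^ (4 - k)) = 4 - k"
    by (simp add: degree_power_eq degree_cyc_poly cyc_poly_nz)
  ultimately show ?thesis by blast
qed

section \<open>Vertices as windows of periodic sequences\<close>

lemma mod_eq_obtain:
  assumes "(i :: int) mod m = j mod m"
  obtains t where "i = j + m * t"
proof -
  have "m dvd i - j" using assms by (simp add: mod_eq_dvd_iff)
  then obtain t where "i - j = m * t" by (rule dvdE)
  then show ?thesis by (intro that[of t]) simp
qed

locale px =
  fixes n k :: nat
  assumes n3: "n \<ge> 3" and k1: "k \<ge> 1" and kn: "k < n"
begin

abbreviation V :: "(int \<Rightarrow> bit) set" where "V \<equiv> cyclic_seqs n"

text \<open>A vertex has many names: only \<open>i\<close> modulo \<open>n\<close> and
  \<open>k\<close> values of \<open>u\<close> count. Whole sequences let automorphisms be given by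
  formulas that do not mention windows.\<close>

definition vt :: "int \<Rightarrow> (int \<Rightarrow> bit) \<Rightarrow> nat \<times> bit list" where
  "vt i u = (nat (i mod int n), map (\<lambda>j. u (i + int j)) [0..<k])"

definition fwd :: "nat \<times> bit list \<Rightarrow> nat \<times> bit list \<Rightarrow> bool" where
  "fwd v w \<longleftrightarrow> (\<exists>i. \<exists>u\<in>V. v = vt i u \<and> w = vt (i + 1) u)"

lemma n_pos: "n > 0" using n3 by simp

lemma V_cong: "c \<in> V \<Longrightarrow> i mod int n = j mod int n \<Longrightarrow> c i = c j"
  by (rule cyclic_seqs_cong)

lemma V_0 [simp]: "(\<lambda>_. 0) \<in> V" by (simp add: cyclic_seqs_def)

lemma V_add: "c \<in> V \<Longrightarrow> d \<in> V \<Longrightarrow> (\<lambda>p. c p + d p) \<in> V"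
  by (simp add: cyclic_seqs_def)

lemma V_shift: "c \<in> V \<Longrightarrow> (\<lambda>p. c (p - r)) \<in> V"
  by (simp add: cyclic_seqs_def) (metis add.commute add_diff_eq)

lemma V_reflect: "c \<in> V \<Longrightarrow> (\<lambda>p. c (q - p)) \<in> V"
proof -
  assume c: "c \<in> V"
  have "c (q - (j + int n)) = c (q - j)" for j by (rule V_cong[OF c]) (simp add: mod_eq_dvd_iff)
  then show ?thesis by (simp add: cyclic_seqs_def)
qed

lemma vt_eq_iff:
  "vt i u = vt i' u' \<longleftrightarrow> i mod int n = i' mod int n \<and> (\<forall>j<k. u (i + int j) = u' (i' + int j))"
  using n_pos by (auto simp: vt_def list_eq_iff_nth_eq nat_eq_iff)

lemma vt_window_iff: "vt i u = vt i u' \<longleftrightarrow> (\<forall>p. i \<le> p \<and> p < i + int k \<longrightarrow> u p = u' p)"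
proof
  assume e: "vt i u = vt i u'"
  show "\<forall>p. i \<le> p \<and> p < i + int k \<longrightarrow> u p = u' p"
  proof (intro allI impI)
    fix p assume "i \<le> p \<and> p < i + int k"
    then show "u p = u' p" using e[unfolded vt_eq_iff] by (auto dest: spec[of _ "nat (p - i)"])
  qed
qed (simp add: vt_eq_iff)

lemma vt_cong: "u \<in> V \<Longrightarrow> i mod int n = i' mod int n \<Longrightarrow> vt i u = vt i' u"
  by (auto simp: vt_eq_iff intro!: V_cong elim!: mod_eq_obtain simp: mod_eq_dvd_iff)

lemma int_fst_vt [simp]: "int (fst (vt i u)) = i mod int n"
  using n_pos by (simp add: vt_def)

text \<open>Shifting by \<open>r\<close> and adding \<open>c\<close> thus acts on vertices, not
  merely on their names.\<close>

lemma vt_plus: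
  assumes "c \<in> V" "vt i u = vt j w"
  shows "vt (i + r) (\<lambda>p. u (p - r) + c p) = vt (j + r) (\<lambda>p. w (p - r) + c p)"
proof -
  have e: "i mod int n = j mod int n" "\<And>m. m < k \<Longrightarrow> u (i + int m) = w (j + int m)"
    using assms(2) by (auto simp: vt_eq_iff)
  obtain t where t: "i = j + int n * t" using e(1) by (rule mod_eq_obtain)
  have "c (i + r + int m) = c (j + r + int m)" for m
    using t by (intro V_cong[OF assms(1)]) (simp add: mod_eq_dvd_iff)
  moreover have "(i + r) mod int n = (j + r) mod int n" using t by (simp add: mod_eq_dvd_iff)
  moreover have "i + r + x - r = i + x" "j + r + x - r = j + x" for x by simp_all
  ultimately show ?thesis using e(2) by (simp add: vt_eq_iff)
qed

text \<open>At most \<open>n\<close> consecutive positions lie in different residue classes, so a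
  word on them extends periodically. Arcs use \<open>m = k + 1\<close>, which requires
  \<open>k < n\<close>.\<close>

lemma word_window:
  assumes "m \<le> n" "length x = m"
  obtains u where "u \<in> V" "\<And>j. j < m \<Longrightarrow> u (i + int j) = x ! j"
proof -
  define u where "u = (\<lambda>p. let r = nat ((p - i) mod int n) in if r < m then x ! r else 0)"
  have "(p + int n - i) mod int n = (p - i) mod int n" for p by (simp add: mod_eq_dvd_iff)
  then have "u \<in> V" by (simp add: u_def cyclic_seqs_def)
  moreover have "u (i + int j) = x ! j" if "j < m" for j using that assms by (simp add: u_def)
  ultimately show ?thesis by (rule that)
qed

lemma pverts_PX: "pverts (PX n k) = {vt i u | i u. u \<in> V}"
proof (intro equalityI subsetI)
  fix v assume "v \<in> pverts (PX n k)"
  then obtain i x where v: "v = (i, x)" "i < n" "length x = k" by (auto simp: PX_def Let_def)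
  obtain u where u: "u \<in> V" "\<And>j. j < k \<Longrightarrow> u (int i + int j) = x ! j"
    using word_window[of k x "int i"] v(3) kn by auto
  have "v = vt (int i) u" using u(2) v by (auto simp: vt_def intro: nth_equalityI)
  then show "v \<in> {vt i u | i u. u \<in> V}" using u(1) by blast
next
  fix v assume "v \<in> {vt i u | i u. u \<in> V}"
  then show "v \<in> pverts (PX n k)" using n_pos by (auto simp: vt_def PX_def Let_def nat_less_iff)
qed

lemma parcs_PX: "(v, w) \<in> parcs (PX n k) \<longleftrightarrow> fwd v w \<or> fwd w v"
proof -
  have "(\<exists>i x. v = (i, butlast x) \<and> w = ((i + 1) mod n, tl x) \<and> i < n \<and> length x = k + 1) \<longleftrightarrow> fwd v w"
    (is "?L v w \<longleftrightarrow> _") for v w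
  proof
    assume "?L v w"
    then obtain i x where x: "v = (i, butlast x)" "w = ((i + 1) mod n, tl x)" "i < n" "length x
      = k + 1"
      by blast
    obtain u where u: "u \<in> V" "\<And>j. j < k + 1 \<Longrightarrow> u (int i + int j) = x ! j"
      using word_window[of "k + 1" x "int i"] x(4) kn by auto
    have "nat ((int i + 1) mod int n) = (i + 1) mod n"
      by (metis nat_int of_nat_1 of_nat_add zmod_int)
    moreover have "u (int i + 1 + int j) = x ! Suc j" if "j < k" for j
      using u(2)[of "Suc j"] that by (simp add: algebra_simps)
    ultimately have "w = vt (int i + 1) u"
      using x(2,4) by (auto simp: vt_def nth_tl intro: nth_equalityI)
    moreover have "v = vt (int i) u" using u(2) x
      by (auto simp: vt_def nth_butlast intro: nth_equalityI)
    ultimately show "fwd v w" using u(1) unfolding fwd_def by blast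
  next
    assume "fwd v w"
    then obtain i u where u: "u \<in> V" "v = vt i u" "w = vt (i + 1) u" by (auto simp: fwd_def)
    define x where "x = map (\<lambda>j. u (i + int j)) [0..<k + 1]"
    have "nat ((i + 1) mod int n) = (nat (i mod int n) + 1) mod n"
    proof -
      have "int (nat ((i + 1) mod int n)) = int ((nat (i mod int n) + 1) mod n)"
        using n_pos by (simp add: zmod_int mod_simps add.commute)
      then show ?thesis by (simp only: of_nat_eq_iff)
    qed
    moreover have "butlast x = map (\<lambda>j. u (i + int j)) [0..<k]" by (simp add: x_def)
    moreover have "tl x = map (\<lambda>j. u (i + 1 + int j)) [0..<k]"
      by (rule nth_equalityI) (simp_all add: x_def nth_tl algebra_simps del: upt_Suc)
    moreover have "nat (i mod int n) < n" using n_pos by (simp add: nat_less_iff)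
    ultimately show "?L v w" using u
      by (intro exI[of _ "nat (i mod int n)"] exI[of _ x]) (simp add: vt_def x_def)
  qed
  then show ?thesis by (simp add: PX_def Let_def)
qed

lemma int_fst_fwd: "fwd v w \<Longrightarrow> int (fst w) = (int (fst v) + 1) mod int n"
  by (auto simp: fwd_def mod_add_left_eq)

lemma wf_PX: "pair_wf_digraph (PX n k)"
proof -
  interpret pair_graph "PX n k" using n3 by (intro pair_graph_PX) simp
  show ?thesis by unfold_locales
qed

section \<open>From a cyclic code to a Cayley graph\<close>

lemma fwd_plus:
  assumes "fwd (vt i u) (vt j w)" "c \<in> V"
  shows "fwd (vt (i + r) (\<lambda>p. u (p - r) + c p)) (vt (j + r) (\<lambda>p. w (p - r) + c p))"
proof -
  obtain l x where x: "x \<in> V" "vt i u = vt l x" "vt j w = vt (l + 1) x"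
    using assms(1) unfolding fwd_def by blast
  let ?x = "\<lambda>p. x (p - r) + c p"
  have "?x \<in> V" using x(1) assms(2) by (intro V_add V_shift)
  then show ?thesis
    using vt_plus[OF assms(2) x(2), of r] vt_plus[OF assms(2) x(3), of r] unfolding fwd_def
    by (intro exI[of _ "l + r"] bexI[of _ ?x]) (simp_all add: algebra_simps)
qed

text \<open>\<open>(i, c)\<close> stands for the shift by \<open>i\<close> followed by adding
  \<open>c\<close>; these maps form a semidirect product \<open>G\<close>. \<open>\<phi>\<close>
  gives the image of the base vertex; it is injective by \<open>window\<close> and onto by
  counting.\<close>

lemma cayley_of_code:
  assumes K: "K \<subseteq> V" "add_subgroup K" "\<And>c. c \<in> K \<Longrightarrow> (\<lambda>j. c (j - 1)) \<in> K"
    and card: "card K = 2 ^ k"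
    and window: "\<And>c i. c \<in> K \<Longrightarrow> (\<And>j. 0 \<le> j \<Longrightarrow> j < int k \<Longrightarrow> c (i + j) = 0) \<Longrightarrow> c = (\<lambda>_. 0)"
  shows "cayley_graph (PX n k)"
proof -
  define m :: "int \<times> (int \<Rightarrow> bit) \<Rightarrow> int \<times> (int \<Rightarrow> bit) \<Rightarrow> int \<times> (int \<Rightarrow> bit)"
    where "m = (\<lambda>(j, u) (i, c). ((j + i) mod int n, \<lambda>p. u (p - i) + c p))"
  define G where "G = \<lparr>carrier = {0..<int n} \<times> K, mult = m, one = (0, \<lambda>_. 0)\<rparr>"
  define \<phi> where "\<phi> = (\<lambda>(i, c). vt i c)"
  define adj where "adj v w \<longleftrightarrow> fwd v w \<or> fwd w v" for v w
  \<comment> \<open>The neighbours of the base vertex: right multiplication by the inverse of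
    \<open>x\<close> moves an edge at \<open>x\<close> to one at the identity.\<close>
  define S where "S = {x \<in> carrier G. adj (\<phi> \<one>\<^bsub>G\<^esub>) (\<phi> x)}"
  have K0: "(\<lambda>_. 0) \<in> K" and Kadd: "\<And>c d. c \<in> K \<Longrightarrow> d \<in> K \<Longrightarrow> (\<lambda>p. c p + d p) \<in> K"
    using K(2) by (auto simp: add_subgroup_def)
  have KV: "c \<in> V" if "c \<in> K" for c using that K(1) by blast
  have shn: "(\<lambda>j. c (j - int l)) \<in> K" if "c \<in> K" for c l
  proof (induction l)
    case (Suc l)
    then show ?case using K(3)[of "\<lambda>j. c (j - int l)"] by (simp add: algebra_simps)
  qed (use that in simp)
  have sh: "(\<lambda>j. c (j - r)) \<in> K" if "c \<in> K" for c r
  proof -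
    have "c (j - int (nat (r mod int n))) = c (j - r)" for j
      using n_pos by (intro V_cong[OF KV[OF that]]) (simp add: mod_diff_right_eq)
    then show ?thesis using shn[OF that, of "nat (r mod int n)"] by simp
  qed
  have cG: "carrier G = {0..<int n} \<times> K" and oG: "\<one>\<^bsub>G\<^esub> = (0, \<lambda>_. 0)" by (simp_all add: G_def)
  \<comment> \<open>The left factor is applied first, so right multiplication is the action on
    vertices.\<close>
  have mG: "(j, u) \<otimes>\<^bsub>G\<^esub> (i, c) = ((j + i) mod int n, \<lambda>p. u (p - i) + c p)" for j u i c
    by (simp add: G_def m_def)
  have grp: "group G"
  proof (rule groupI)
    fix x y assume "x \<in> carrier G" "y \<in> carrier G"
    then show "x \<otimes>\<^bsub>G\<^esub> y \<in> carrier G"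
      using n_pos Kadd sh by (cases x; cases y) (auto simp: cG mG)
  next
    fix x y z assume xyz: "x \<in> carrier G" "y \<in> carrier G" "z \<in> carrier G"
    obtain i u j v l w where [simp]: "x = (i, u)" "y = (j, v)" "z = (l, w)"
      by (cases x; cases y; cases z) auto
    have "u (p - l - j) = u (p - (j + l) mod int n)" for p
      using xyz(1) KV by (intro V_cong) (auto simp: cG mod_diff_right_eq algebra_simps)
    then show "x \<otimes>\<^bsub>G\<^esub> y \<otimes>\<^bsub>G\<^esub> z = x \<otimes>\<^bsub>G\<^esub> (y \<otimes>\<^bsub>G\<^esub> z)"
      by (simp add: mG mod_simps add.assoc)
  next
    fix x assume x: "x \<in> carrier G"
    obtain i c where [simp]: "x = (i, c)" by (cases x)
    have ic: "0 \<le> i" "i < int n" "c \<in> K" using x by (auto simp: cG)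
    show "\<one>\<^bsub>G\<^esub> \<otimes>\<^bsub>G\<^esub> x = x" using ic by (simp add: oG mG)
    have "(\<lambda>p. c (p + i)) \<in> K" using sh[OF ic(3), of "- i"] by simp
    then show "\<exists>y\<in>carrier G. y \<otimes>\<^bsub>G\<^esub> x = \<one>\<^bsub>G\<^esub>"
      using n_pos by (intro bexI[of _ "((- i) mod int n, \<lambda>p. c (p + i))"]) (auto simp: cG mG oG
        mod_simps)
  qed (use n_pos K0 in \<open>auto simp: oG cG\<close>)
  interpret G: group G by (rule grp)
  have trans: "adj (\<phi> (x \<otimes>\<^bsub>G\<^esub> g)) (\<phi> (y \<otimes>\<^bsub>G\<^esub> g))"
    if a: "adj (\<phi> x) (\<phi> y)" and g: "g \<in> carrier G" and xy: "x \<in> carrier G" "y \<in> carrier G" for x y g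
  proof -
    obtain i u j v l c where e: "x = (i, u)" "y = (j, v)" "g = (l, c)"
      by (cases x; cases y; cases g) auto
    have V: "u \<in> V" "v \<in> V" "c \<in> V" using xy g KV by (auto simp: e cG)
    have \<phi>: "\<phi> ((i, u) \<otimes>\<^bsub>G\<^esub> (l, c)) = vt (i + l) (\<lambda>p. u (p - l) + c p)" if "u \<in> V" for i u
      unfolding \<phi>_def mG split using that V by (intro vt_cong V_add V_shift) simp_all
    show ?thesis using a fwd_plus[OF _ V(3)] V unfolding adj_def e \<phi>[OF V(1)] \<phi>[OF V(2)]
      by (auto simp: \<phi>_def)
  qed
  have trans_iff: "adj (\<phi> (x \<otimes>\<^bsub>G\<^esub> g)) (\<phi> (y \<otimes>\<^bsub>G\<^esub> g)) \<longleftrightarrow> adj (\<phi> x) (\<phi> y)"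
    if "g \<in> carrier G" "x \<in> carrier G" "y \<in> carrier G" for x y g
    using trans[of "x \<otimes>\<^bsub>G\<^esub> g" "y \<otimes>\<^bsub>G\<^esub> g" "inv\<^bsub>G\<^esub> g"] trans[of x y g] that by (auto simp: G.m_assoc)
  have noloop: "\<not> adj v v" if "v = vt i u" for v i u
  proof
    assume "adj v v"
    then have "i mod int n = (i + 1) mod int n"
      using int_fst_fwd[of v v] that by (auto simp: adj_def mod_simps)
    then have "int n dvd 1" by (metis mod_eq_dvd_iff add_diff_cancel_left' dvd_minus_iff
      minus_diff_eq)
    then show False using n3 by simp
  qed
  have inj: "inj_on \<phi> (carrier G)"
  proof (rule inj_onI)
    fix x y assume xy: "x \<in> carrier G" "y \<in> carrier G" "\<phi> x = \<phi> y"
    obtain i u j v where e: "x = (i, u)" "y = (j, v)" by (cases x; cases y) auto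
    have uv: "0 \<le> i" "i < int n" "0 \<le> j" "j < int n" "u \<in> K" "v \<in> K" using xy by (auto simp: e cG)
    have "vt i u = vt j v" using xy(3) by (simp add: e \<phi>_def)
    then have "i mod int n = j mod int n" by (simp add: vt_eq_iff)
    then have ij: "i = j" using uv by simp
    \<comment> \<open>The sum vanishes on the window at \<open>i\<close>, hence everywhere by
      \<open>window\<close>.\<close>
    then have "(\<lambda>p. u p + v p) = (\<lambda>_. 0)"
      using \<open>vt i u = vt j v\<close> uv
        by (intro window[of _ i] Kadd) (simp_all add: vt_window_iff bit_add_eq_0_iff)
    then have "u = v" by (simp add: fun_eq_iff bit_add_eq_0_iff)
    then show "x = y" using ij e by simp
  qed
  have "\<phi> ` carrier G = pverts (PX n k)"
  proof (rule card_subset_eq)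
    interpret P: pair_graph "PX n k" using n3 by (intro pair_graph_PX) simp
    show "finite (pverts (PX n k))" using P.pair_finite_verts .
    show "\<phi> ` carrier G \<subseteq> pverts (PX n k)" using KV by (auto simp: cG \<phi>_def pverts_PX)
    show "card (\<phi> ` carrier G) = card (pverts (PX n k))"
      unfolding card_image[OF inj] card_verts_PX by (simp add: cG card_cartesian_product card)
  qed
  then have bij: "bij_betw \<phi> (carrier G) (pverts (PX n k))" using inj by (simp add: bij_betw_def)
  have S: "connection_set G S"
  proof -
    have inv: "inv\<^bsub>G\<^esub> x \<in> S" if "x \<in> S" for x
    proof -
      have x: "x \<in> carrier G" "adj (\<phi> \<one>\<^bsub>G\<^esub>) (\<phi> x)" using that by (auto simp: S_def)
      then have "adj (\<phi> \<one>\<^bsub>G\<^esub>) (\<phi> (inv\<^bsub>G\<^esub> x))"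
        using trans_iff[of x "\<one>\<^bsub>G\<^esub>" "inv\<^bsub>G\<^esub> x"] by (auto simp: adj_def)
      then show ?thesis using x by (simp add: S_def)
    qed
    have Sc: "S \<subseteq> carrier G" by (auto simp: S_def)
    have "S = m_inv G ` S"
    proof (intro equalityI subsetI)
      fix x assume "x \<in> S"
      then show "x \<in> m_inv G ` S" using inv[of x] Sc by (intro image_eqI[of _ _ "inv\<^bsub>G\<^esub> x"]) auto
    qed (use inv in auto)
    moreover have "\<one>\<^bsub>G\<^esub> \<notin> S" using noloop[of "\<phi> \<one>\<^bsub>G\<^esub>" 0 "\<lambda>_. 0"] by (auto simp: S_def \<phi>_def oG)
    ultimately show ?thesis using Sc by (auto simp: connection_set_def)
  qed
  have "digraph_iso (with_proj (PX n k)) (with_proj (Cay G S))"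
    unfolding digraph_iso_with_proj_iff[OF wf_PX pair_wf_digraph_Cay]
  proof (intro exI[of _ "the_inv_into (carrier G) \<phi>"] conjI ballI)
    show "bij_betw (the_inv_into (carrier G) \<phi>) (pverts (PX n k)) (pverts (Cay G S))"
      using bij_betw_the_inv_into[OF bij] by (simp add: Cay_def)
    fix v w assume "v \<in> pverts (PX n k)" "w \<in> pverts (PX n k)"
    then have "v \<in> \<phi> ` carrier G" "w \<in> \<phi> ` carrier G" using bij_betw_imp_surj_on[OF bij] by simp_all
    then obtain x y where xy: "x \<in> carrier G" "y \<in> carrier G" "v = \<phi> x" "w = \<phi> y" by blast
    have "(v, w) \<in> parcs (PX n k) \<longleftrightarrow> adj (\<phi> x) (\<phi> y)" by (simp add: parcs_PX adj_def xy)
    also have "\<dots> \<longleftrightarrow> y \<otimes>\<^bsub>G\<^esub> inv\<^bsub>G\<^esub> x \<in> S"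
      using trans_iff[of "inv\<^bsub>G\<^esub> x" x y] xy by (simp add: S_def)
    finally show "(v, w) \<in> parcs (PX n k) \<longleftrightarrow>
        (the_inv_into (carrier G) \<phi> v, the_inv_into (carrier G) \<phi> w) \<in> parcs (Cay G S)"
      using xy by (simp add: Cay_def the_inv_into_f_f[OF inj])
  qed
  then show ?thesis by (rule cayley_graphI[OF wf_PX grp S])
qed

lemma cayley_if_divisor:
  assumes "g dvd cyc_poly n" "degree g = n - k"
  shows "cayley_graph (PX n k)"
proof (rule cayley_of_code)
  show "card (code_of n g) = 2 ^ k" using card_code_of[OF n_pos assms(1)] assms(2) kn by simp
  show "c = (\<lambda>_. 0)" if "c \<in> code_of n g" "\<And>j. 0 \<le> j \<Longrightarrow> j < int k \<Longrightarrow> c (i + j) = 0" for c i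
    using code_of_window_0[OF n_pos assms(1) that(1), of i] that(2) assms(2) kn
      by (auto simp: of_nat_diff)
qed (use code_of_subset add_subgroup_code_of code_of_shift[OF n_pos] in auto)

end

section \<open>Automorphisms\<close>

context px
begin

definition upd :: "int \<Rightarrow> bit \<Rightarrow> (int \<Rightarrow> bit) \<Rightarrow> int \<Rightarrow> bit" where
  "upd p b u = (\<lambda>j. if j mod int n = p mod int n then b else u j)"

lemma upd_in_V: "u \<in> V \<Longrightarrow> upd p b u \<in> V"
  by (simp add: cyclic_seqs_def upd_def)

lemma upd_same [simp]: "upd p b u p = b"
  by (simp add: upd_def)

lemma upd_other: "p < j \<Longrightarrow> j < p + int n \<Longrightarrow> upd p b u j = u j"
  using zdvd_not_zless[of "j - p" "int n"] by (simp add: upd_def mod_eq_dvd_iff)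

lemma upd_other': "j < p \<Longrightarrow> p < j + int n \<Longrightarrow> upd p b u j = u j"
  using zdvd_not_zless[of "p - j" "int n"] by (simp add: upd_def mod_eq_dvd_iff dvd_diff_commute)

text \<open>One turns \<open>u\<close> into \<open>u'\<close> by changing one residue class at a
  time.\<close>

lemma V_change:
  assumes "finite X" "\<And>p b u. p \<in> X \<Longrightarrow> u \<in> V \<Longrightarrow> F (upd p b u) = F u"
    and "u \<in> V" "u' \<in> V" "\<And>j. (\<And>p. p \<in> X \<Longrightarrow> j mod int n \<noteq> p mod int n) \<Longrightarrow> u j = u' j"
  shows "F u = F u'"
  using assms
proof (induction X arbitrary: u)
  case empty
  then have "u = u'" by auto
  then show ?case by simp
next
  case (insert p X)
  have "F (upd p (u' p) u) = F u'"
  proof (rule insert.IH)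
    fix j assume j: "\<And>q. q \<in> X \<Longrightarrow> j mod int n \<noteq> q mod int n"
    show "upd p (u' p) u j = u' j"
    proof (cases "j mod int n = p mod int n")
      case True
      then show ?thesis using V_cong[OF insert.prems(3) True] by (simp add: upd_def)
    next
      case False
      then have "u j = u' j" using j by (intro insert.prems(4)) auto
      then show ?thesis using False by (simp add: upd_def)
    qed
  qed (use insert.prems upd_in_V in auto)
  then show ?case using insert.prems(1)[of p u "u' p"] insert.prems(2) by simp
qed

text \<open>
  This is connectedness of the graph: a window never covers the whole cycle, so the uncovered
  coordinates can be changed without moving.
\<close>

lemma vt_invariant_const:
  assumes step: "\<And>i u. u \<in> V \<Longrightarrow> H (i + 1) u = H i u"
    and cong: "\<And>i u u'. u \<in> V \<Longrightarrow> u' \<in> V \<Longrightarrow> vt i u = vt i u' \<Longrightarrow> H i u = H i u'"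
    and u: "u \<in> V" "u' \<in> V"
  shows "H i u = H j u'"
proof -
  have 0: "H i u = H 0 u" if "u \<in> V" for i u
  proof (induction i rule: int_induct[where k = 0])
    case (step1 i)
    then show ?case using step[OF that, of i] by simp
  next
    case (step2 i)
    then show ?case using step[OF that, of "i - 1"] by simp
  qed simp
  have "H 0 u = H 0 u'"
  proof (rule V_change[of "{0..<int n}" "H 0"])
    fix p b v assume v: "v \<in> V"
    \<comment> \<open>The window at \<open>p + 1\<close> ends at \<open>p + k\<close>, before the
      next position congruent to \<open>p\<close>.\<close>
    have "H (p + 1) (upd p b v) = H (p + 1) v"
      using kn by (intro cong upd_in_V v) (auto simp: vt_window_iff upd_other)
    then show "H 0 (upd p b v) = H 0 v" using 0 v upd_in_V by metis
  next
    fix j assume "\<And>p. p \<in> {0..<int n} \<Longrightarrow> j mod int n \<noteq> p mod int n"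
    from this[of "j mod int n"] show "u j = u' j" using n_pos by simp
  qed (use u in auto)
  then show ?thesis using 0 u by metis
qed

section \<open>Automorphisms that preserve or reverse the orientation\<close>

lemma length_snd_vt [simp]: "length (snd (vt i u)) = k"
  by (simp add: vt_def)

lemma nth_snd_vt: "j < k \<Longrightarrow> snd (vt i u) ! j = u (i + int j)"
  by (simp add: vt_def)

lemma fwd_vt: "u \<in> V \<Longrightarrow> fwd (vt i u) (vt (i + 1) u)"
  by (auto simp: fwd_def)

lemma nth_snd_fwd: "fwd v w \<Longrightarrow> Suc j < k \<Longrightarrow> snd w ! j = snd v ! Suc j"
  by (auto simp: fwd_def nth_snd_vt algebra_simps)

lemma vt_eqI:
  assumes "int (fst v) = i mod int n" "length (snd v) = k" "\<And>j. j < k \<Longrightarrow> snd v ! j = u (i + int j)"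
  shows "v = vt i u"
proof (rule prod_eqI)
  show "fst v = fst (vt i u)" using assms(1) by (metis int_fst_vt of_nat_eq_iff)
  show "snd v = snd (vt i u)" using assms(2,3) by (intro nth_equalityI) (simp_all add: nth_snd_vt)
qed

text \<open>Levels advance together, so they differ by a constant \<open>r\<close>. Overlapping
  windows make each image bit a function \<open>\<phi> p u\<close> of the position. It can be read
  off windows avoiding any other given position, so it depends on \<open>u p\<close> only;
  injectivity makes it \<open>u p + c p\<close>.\<close>

lemma fwd_preserving_form:
  assumes f: "\<And>v w. fwd v w \<Longrightarrow> fwd (f v) (f w)"
    and inj: "\<And>i u u'. u \<in> V \<Longrightarrow> u' \<in> V \<Longrightarrow> f (vt i u) = f (vt i u') \<Longrightarrow> vt i u = vt i u'"
    and im: "\<And>i u. u \<in> V \<Longrightarrow> \<exists>j w. f (vt i u) = vt j w"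
  shows "\<exists>r. \<exists>c\<in>V. \<forall>i. \<forall>u\<in>V. f (vt i u) = vt (i + r) (\<lambda>p. u (p - r) + c p)"
proof -
  \<comment> \<open>The term \<open>- 0\<close> makes \<open>r\<close> an instance of the function
    \<open>H\<close> below at level 0.\<close>
  define r where "r = (int (fst (f (vt 0 (\<lambda>_. 0)))) - 0) mod int n"
  have "(int (fst (f (vt i u))) - i) mod int n = r" if "u \<in> V" for i u
    unfolding r_def
  proof (rule vt_invariant_const[where H = "\<lambda>i u. (int (fst (f (vt i u))) - i) mod int n"])
    fix i u assume u: "u \<in> V"
    show "(int (fst (f (vt (i + 1) u))) - (i + 1)) mod int n
      = (int (fst (f (vt i u))) - i) mod int n"
      unfolding int_fst_fwd[OF f[OF fwd_vt[OF u, of i]]] by (simp add: mod_simps)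
  qed (use that in auto)
  then have "(int (fst (f (vt i u))) - i + i) mod int n = (r + i) mod int n" if "u \<in> V" for i u
    using that by (metis mod_add_left_eq)
  moreover have "int (fst (f (vt i u))) < int n" if u: "u \<in> V" for i u
    using im[OF u, of i] n_pos by (metis int_fst_vt of_nat_0_less_iff pos_mod_bound)
  ultimately have lev: "int (fst (f (vt i u))) = (i + r) mod int n" if "u \<in> V" for i u
    using that by (metis add.commute diff_add_cancel mod_pos_pos_trivial of_nat_0_le_iff)
  have len: "length (snd (f (vt i u))) = k" if u: "u \<in> V" for i u
    using im[OF u, of i] by auto
  define \<phi> where "\<phi> p u = snd (f (vt p u)) ! 0" for p u
  have bits: "snd (f (vt i u)) ! j = \<phi> (i + int j) u" if "j < k" "u \<in> V" for i j u
    using that(1)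
  proof (induction j arbitrary: i)
    case (Suc j)
    then show ?case
      using nth_snd_fwd[OF f[OF fwd_vt[OF that(2), of i]], of j] Suc.IH[of "i + 1"]
        by (simp add: algebra_simps)
  qed (simp add: \<phi>_def)
  have one: "\<phi> p (upd q b u) = \<phi> p u" if u: "u \<in> V" and q: "p < q" "q < p + int n" for p q b u
  proof -
    define m where "m = nat (q - p)"
    have m: "q = p + int m" "1 \<le> m" "m < n" using q by (auto simp: m_def)
    \<comment> \<open>The window at \<open>p - j\<close> still contains \<open>p\<close> but stops
      before \<open>q\<close>; the truncated difference covers \<open>m \<ge> k\<close>.\<close>
    define j where "j = k - m"
    have j: "j < k" "k \<le> m + j" "m + j < n" using m kn k1 by (auto simp: j_def)
    have "vt (p - int j) (upd q b u) = vt (p - int j) u"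
      unfolding vt_window_iff using j m by (auto intro!: upd_other')
    then show ?thesis using bits[of j u "p - int j"] bits[of j "upd q b u" "p - int j"] j(1) u
      upd_in_V by simp
  qed
  \<comment> \<open>The positions strictly between \<open>p\<close> and \<open>p + n\<close>
    represent all residue classes but that of \<open>p\<close>.\<close>
  have loc: "\<phi> p u = \<phi> p u'" if u: "u \<in> V" "u' \<in> V" and e: "u p = u' p" for p u u'
  proof (rule V_change[of "{p<..<p + int n}" "\<phi> p"])
    fix j assume j: "\<And>q. q \<in> {p<..<p + int n} \<Longrightarrow> j mod int n \<noteq> q mod int n"
    have "(j - p) mod int n = 0"
    proof (rule ccontr)
      assume a: "(j - p) mod int n \<noteq> 0"
      have "0 \<le> (j - p) mod int n" "(j - p) mod int n < int n" using n_pos by simp_all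
      then show False using j[of "p + (j - p) mod int n"] a by (simp add: mod_add_right_eq)
    qed
    then have "j mod int n = p mod int n" by (simp add: mod_eq_dvd_iff dvd_eq_mod_eq_0)
    then show "u j = u' j" using e V_cong u by metis
  qed (use u one in auto)
  \<comment> \<open>If the bit at \<open>p\<close> had no influence, \<open>f\<close> would identify
    two windows at \<open>p\<close> that differ only in their first bit.\<close>
  define c where "c p = \<phi> p (\<lambda>_. 0)" for p
  have ne: "\<phi> p (upd p 1 (\<lambda>_. 0)) \<noteq> c p" for p
  proof
    let ?u = "upd p 1 (\<lambda>_. 0)"
    assume a: "\<phi> p ?u = c p"
    have uV: "?u \<in> V" by (simp add: upd_in_V)
    have "f (vt p ?u) = f (vt p (\<lambda>_. 0))"
    proof (intro prod_eqI nth_equalityI)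
      show "fst (f (vt p ?u)) = fst (f (vt p (\<lambda>_. 0)))" using lev uV by (metis V_0 of_nat_eq_iff)
      fix j assume "j < length (snd (f (vt p ?u)))"
      then have j: "j < k" using len uV by simp
      have "\<phi> (p + int j) ?u = \<phi> (p + int j) (\<lambda>_. 0)"
      proof (cases "j = 0")
        case False
        then show ?thesis using j kn uV by (intro loc) (auto intro: upd_other)
      qed (use a c_def in simp)
      then show "snd (f (vt p ?u)) ! j = snd (f (vt p (\<lambda>_. 0))) ! j" using bits[OF j] uV by simp
    qed (use len uV in simp)
    then have "vt p ?u = vt p (\<lambda>_. 0)" using inj uV by simp
    then have "?u p = 0" using k1 unfolding vt_window_iff
      by (metis of_nat_0_less_iff order_refl less_add_same_cancel1 less_le_trans zero_less_one)
    then show False by simp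
  qed
  have \<phi>: "\<phi> p u = u p + c p" if u: "u \<in> V" for p u
  proof (cases "u p = 0")
    case True
    then show ?thesis using loc[OF u V_0, of p] by (simp add: c_def)
  next
    case False
    then have "\<phi> p u = \<phi> p (upd p 1 (\<lambda>_. 0))" using u by (intro loc) (auto simp: upd_in_V)
    then show ?thesis using False ne[of p] by (cases "c p" rule: bit.exhaust) auto
  qed
  have "vt (p + int n) (\<lambda>_. 0) = vt p (\<lambda>_. 0)" for p by (simp add: vt_eq_iff)
  then have cV: "c \<in> V" by (simp add: cyclic_seqs_def c_def \<phi>_def)
  \<comment> \<open>\<open>\<phi>\<close> is indexed by source positions; position \<open>p\<close>
    of the image comes from \<open>p - r\<close>.\<close>
  have "f (vt i u) = vt (i + r) (\<lambda>p. u (p - r) + c (p - r))" if u: "u \<in> V" for i u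
    using lev[OF u] len[OF u] bits[OF _ u] \<phi>[OF u] by (intro vt_eqI) (simp_all add: algebra_simps)
  then show ?thesis using V_shift[OF cV, of r]
    by (intro exI[of _ r] bexI[of _ "\<lambda>p. c (p - r)"]) auto
qed

text \<open>Induced by negating positions: the window from \<open>i\<close> to
  \<open>i + k - 1\<close> becomes the one that starts at \<open>- i - k + 1\<close>.\<close>

definition reflect :: "nat \<times> bit list \<Rightarrow> nat \<times> bit list" where
  "reflect v = (nat ((- int (fst v) - int k + 1) mod int n), rev (snd v))"

lemma reflect_vt: "reflect (vt i u) = vt (- i - int k + 1) (\<lambda>p. u (- p))"
proof (rule vt_eqI)
  have "(- (i mod int n) - int k + 1) mod int n = (- i - int k + 1) mod int n"
  proof -
    have "- (i mod int n) - int k + 1 = (- i - int k + 1) + int n * (i div int n)"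
      by (simp flip: minus_mult_div_eq_mod)
    then show ?thesis by (simp only: mod_mult_self2)
  qed
  then show "int (fst (reflect (vt i u))) = (- i - int k + 1) mod int n"
    using n_pos by (simp add: reflect_def)
  fix j assume "j < k"
  then show "snd (reflect (vt i u)) ! j = u (- (- i - int k + 1 + int j))"
    by (simp add: reflect_def rev_nth nth_snd_vt algebra_simps)
qed (simp add: reflect_def)

lemma reflect_reflect_vt: "reflect (reflect (vt i u)) = vt i u"
  by (simp add: reflect_vt)

lemma V_minus: "u \<in> V \<Longrightarrow> (\<lambda>p. u (- p)) \<in> V"
  using V_reflect[of u 0] by simp

lemma fwd_reflect: "fwd v w \<Longrightarrow> fwd (reflect w) (reflect v)"
  unfolding fwd_def
  by (elim exE bexE conjE, rule_tac x = "- i - int k" in exI, rule_tac x = "\<lambda>p. u (- p)" in bexI)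
    (auto simp: reflect_vt V_minus algebra_simps)

text \<open>Composition with \<open>reflect\<close>, which reverses every arc, reduces this to the
  orientation-preserving case.\<close>

lemma fwd_reversing_form:
  assumes f: "\<And>v w. fwd v w \<Longrightarrow> fwd (f w) (f v)"
    and inj: "\<And>i u j u'. u \<in> V \<Longrightarrow> u' \<in> V \<Longrightarrow> f (vt i u) = f (vt j u') \<Longrightarrow> vt i u = vt j u'"
    and im: "\<And>i u. u \<in> V \<Longrightarrow> \<exists>j w. f (vt i u) = vt j w"
  shows "\<exists>q. \<exists>c\<in>V. \<forall>i. \<forall>u\<in>V. f (vt i u) = vt (q - i - int k + 1) (\<lambda>p. u (q - p) + c p)"
proof -
  have "\<exists>r. \<exists>c\<in>V. \<forall>i. \<forall>u\<in>V. (f \<circ> reflect) (vt i u) = vt (i + r) (\<lambda>p. u (p - r) + c p)"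
  proof (rule fwd_preserving_form)
    show "\<And>v w. fwd v w \<Longrightarrow> fwd ((f \<circ> reflect) v) ((f \<circ> reflect) w)" using f fwd_reflect by simp
    fix i u assume u: "u \<in> V"
    show "\<exists>j w. (f \<circ> reflect) (vt i u) = vt j w" using im u by (simp add: reflect_vt V_minus)
    fix u' assume "u' \<in> V" "(f \<circ> reflect) (vt i u) = (f \<circ> reflect) (vt i u')"
    then have "reflect (vt i u) = reflect (vt i u')" unfolding comp_def reflect_vt using u
      by (intro inj V_minus)
    then show "vt i u = vt i u'" by (metis reflect_reflect_vt)
  qed
  then obtain r c where c: "c \<in> V"
    and g: "\<And>i u. u \<in> V \<Longrightarrow> f (reflect (vt i u)) = vt (i + r) (\<lambda>p. u (p - r) + c p)" by auto
  have "f (vt i u) = vt (r - i - int k + 1) (\<lambda>p. u (r - p) + c p)" if "u \<in> V" for i u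
    using g[OF V_minus[OF that], of "- i - int k + 1"] reflect_reflect_vt[of i u]
    by (simp add: reflect_vt algebra_simps)
  then show ?thesis using c by blast
qed

section \<open>Common neighbours and the orientation\<close>

definition adj :: "nat \<times> bit list \<Rightarrow> nat \<times> bit list \<Rightarrow> bool" where
  "adj v w \<longleftrightarrow> fwd v w \<or> fwd w v"

lemma adj_sym: "adj v w \<Longrightarrow> adj w v" by (auto simp: adj_def)

text \<open>The index of an arc can be aligned with \<open>i\<close>, but \<open>u\<close> itself
  need not serve: the last bit of \<open>w\<close> lies outside the window at
  \<open>i\<close>.\<close>

lemma fwd_from_vt:
  assumes "fwd (vt i u) w" "u \<in> V"
  obtains x where "x \<in> V" "vt i x = vt i u" "w = vt (i + 1) x"
proof -
  obtain j x where x: "x \<in> V" "vt i u = vt j x" "w = vt (j + 1) x" using assms(1)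
    by (auto simp: fwd_def)
  then have "i mod int n = j mod int n" by (simp add: vt_eq_iff)
  then obtain t where t: "i = j + int n * t" by (rule mod_eq_obtain)
  have "vt i x = vt j x" "vt (i + 1) x = vt (j + 1) x"
    by (rule vt_cong[OF x(1)]; simp add: t mod_eq_dvd_iff)+
  then show ?thesis using x by (intro that) auto
qed

lemma fwd_to_vt:
  assumes "fwd v (vt (i + 1) u)" "u \<in> V"
  obtains x where "x \<in> V" "v = vt i x" "vt (i + 1) x = vt (i + 1) u"
proof -
  obtain j x where x: "x \<in> V" "v = vt j x" "vt (i + 1) u = vt (j + 1) x" using assms(1)
    by (auto simp: fwd_def)
  then have "(i + 1) mod int n = (j + 1) mod int n" by (simp add: vt_eq_iff)
  then obtain t where t: "i + 1 = j + 1 + int n * t" by (rule mod_eq_obtain)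
  have "vt i x = vt j x" "vt (i + 1) x = vt (j + 1) x"
    by (rule vt_cong[OF x(1)]; use t in \<open>simp add: mod_eq_dvd_iff\<close>)+
  then show ?thesis using x by (intro that) auto
qed

text \<open>Flip the first bit of \<open>z\<close>; its position is outside the next window because
  \<open>k < n\<close>.\<close>

lemma two_outs:
  assumes "fwd z a" "fwd z b"
  obtains z' where "z' \<noteq> z" "fwd z' a" "fwd z' b"
proof -
  obtain i u where u: "u \<in> V" "z = vt i u" "a = vt (i + 1) u" using assms(1) by (auto simp: fwd_def)
  obtain x where x: "x \<in> V" "vt i x = vt i u" "b = vt (i + 1) x"
    using assms(2) u fwd_from_vt by metis
  let ?p = "upd i (u i + 1)"
  have e: "vt (i + 1) (?p y) = vt (i + 1) y" for y
    using kn by (auto simp: vt_window_iff upd_other)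
  have "vt i (?p x) = vt i (?p u)" using x(2) by (auto simp: vt_window_iff upd_def)
  then have "fwd (vt i (?p u)) a" "fwd (vt i (?p u)) b"
    using fwd_vt[OF upd_in_V, of u i i "u i + 1"] fwd_vt[OF upd_in_V, of x i i "u i + 1"] u x e
      by auto
  moreover have "vt i (?p u) \<noteq> z"
    using u(2) k1 by (auto simp: vt_window_iff intro!: exI[of _ i])
  ultimately show ?thesis using that by blast
qed

text \<open>Dually, flip the last bit of \<open>z\<close>, whose position is outside the previous
  window.\<close>

lemma two_ins:
  assumes "fwd a z" "fwd b z"
  obtains z' where "z' \<noteq> z" "fwd a z'" "fwd b z'"
proof -
  obtain i u where u: "u \<in> V" "a = vt i u" "z = vt (i + 1) u" using assms(1) by (auto simp: fwd_def)
  obtain x where x: "x \<in> V" "b = vt i x" "vt (i + 1) x = vt (i + 1) u"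
    using assms(2) u fwd_to_vt by metis
  let ?p = "upd (i + int k) (u (i + int k) + 1)"
  have e: "vt i (?p y) = vt i y" for y
    using kn by (auto simp: vt_window_iff upd_other')
  have "vt (i + 1) (?p x) = vt (i + 1) (?p u)" using x(3) by (auto simp: vt_window_iff upd_def)
  then have "fwd a (vt (i + 1) (?p u))" "fwd b (vt (i + 1) (?p u))"
    using fwd_vt[OF upd_in_V, of u i "i + int k" "u (i + int k) + 1"]
      fwd_vt[OF upd_in_V, of x i "i + int k" "u (i + int k) + 1"] u x e by auto
  moreover have "vt (i + 1) (?p u) \<noteq> z"
    using u(3) k1 by (auto simp: vt_window_iff intro!: exI[of _ "i + int k"])
  ultimately show ?thesis using that by blast
qed

text \<open>In this form the steps of a closed walk can be added up.\<close>

lemma fwd_dvd: "fwd v w \<Longrightarrow> int n dvd int (fst w) - int (fst v) - 1"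
  using int_fst_fwd[of v w] by (metis diff_diff_eq dvd_minus_mod dvd_diff_commute)

lemma length_snd_fwd: "fwd v w \<Longrightarrow> length (snd v) = k \<and> length (snd w) = k"
  by (auto simp: fwd_def)

end

text \<open>The excluded cases violate \<open>in_out_unique\<close>: for \<open>k = 1\<close> the
  vertices of one level share all neighbours, and for \<open>n = 4\<close> the four windows of one
  sequence form a directed cycle.\<close>

locale px_rigid = px +
  assumes k2: "k \<ge> 2" and n4: "n \<noteq> 4"
begin

text \<open>The signed steps around \<open>b\<close>, \<open>z\<close>, \<open>a\<close>,
  \<open>z'\<close> add up to a multiple of \<open>n\<close>, so \<open>z'\<close> too must lead
  from \<open>b\<close> to \<open>a\<close>. Then \<open>a\<close> determines all bits of
  \<open>z'\<close> but the first, and \<open>b\<close> the first because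
  \<open>k \<ge> 2\<close>.\<close>

lemma in_out_unique:
  assumes za: "fwd z a" and bz: "fwd b z" and "adj a z'" "adj b z'"
  shows "z' = z"
proof -
  have two: "\<not> int n dvd 2" using n3 zdvd_imp_le[of "int n" 2] by auto
  have four: "\<not> int n dvd 4"
  proof
    assume "int n dvd 4"
    then have "n dvd 4" by (metis of_nat_dvd_iff of_nat_numeral)
    then have "n \<le> 4" by (simp add: dvd_imp_le)
    then have "n = 3" using n3 n4 by simp
    then show False using \<open>n dvd 4\<close> by simp
  qed
  note d = fwd_dvd[OF za] fwd_dvd[OF bz]
  consider "fwd a z'" "fwd b z'" | "fwd a z'" "fwd z' b" | "fwd z' a" "fwd z' b" | "fwd z' a" "fwd
    b z'"
    using assms by (auto simp: adj_def)
  then show ?thesis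
  proof cases
    case 1
    have "int n dvd (int (fst z') - int (fst b) - 1) - (int (fst z) - int (fst b) - 1)
        - (int (fst a) - int (fst z) - 1) - (int (fst z') - int (fst a) - 1)"
      by (intro dvd_diff d fwd_dvd 1)
    then show ?thesis using two by simp
  next
    case 2
    have "int n dvd (int (fst b) - int (fst z') - 1) + (int (fst z) - int (fst b) - 1)
        + (int (fst a) - int (fst z) - 1) + (int (fst z') - int (fst a) - 1)"
      by (intro dvd_add d fwd_dvd 2)
    then show ?thesis using four by simp
  next
    case 3
    have "int n dvd (int (fst a) - int (fst z') - 1) - (int (fst b) - int (fst z') - 1)
        - (int (fst a) - int (fst z) - 1) - (int (fst z) - int (fst b) - 1)"
      by (intro dvd_diff d fwd_dvd 3)
    then show ?thesis using two by simp
  next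
    case 4
    show ?thesis
    proof (intro prod_eqI nth_equalityI)
      show "fst z' = fst z" using int_fst_fwd[OF 4(2)] int_fst_fwd[OF bz] by simp
      fix j assume "j < length (snd z')"
      then have j: "j < k" using length_snd_fwd[OF 4(1)] by simp
      show "snd z' ! j = snd z ! j"
      proof (cases j)
        case 0
        then show ?thesis using nth_snd_fwd[OF 4(2), of 0] nth_snd_fwd[OF bz, of 0] k2 by simp
      next
        case (Suc l)
        then show ?thesis using nth_snd_fwd[OF 4(1), of l] nth_snd_fwd[OF za, of l] j by simp
      qed
    qed (use length_snd_fwd[OF 4(1)] length_snd_fwd[OF za] in simp)
  qed
qed

text \<open>If both arcs of a path of length two leave its centre, or both enter it, the ends have a
  further common neighbour; if the path passes through, they have none. \<open>f\<close> respects
  this distinction, so its effect on one arc spreads to all.\<close>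

lemma fwd_dichotomy:
  assumes adj: "\<And>v w. v \<in> pverts (PX n k) \<Longrightarrow> w \<in> pverts (PX n k) \<Longrightarrow> adj v w \<longleftrightarrow> adj (f v) (f w)"
    and bij: "bij_betw f (pverts (PX n k)) (pverts (PX n k))"
  shows "(\<forall>v w. fwd v w \<longrightarrow> fwd (f v) (f w)) \<or> (\<forall>v w. fwd v w \<longrightarrow> fwd (f w) (f v))"
proof -
  have W: "v \<in> pverts (PX n k)" "w \<in> pverts (PX n k)" if "fwd v w" for v w
    using that by (auto simp: fwd_def pverts_PX)
  have inj: "v = w" if "f v = f w" "v \<in> pverts (PX n k)" "w \<in> pverts (PX n k)" for v w
    using that bij by (meson bij_betw_def inj_onD)
  have fadj: "fwd (f v) (f w) \<or> fwd (f w) (f v)" if "fwd v w" for v w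
    using adj[OF W[OF that]] that by (auto simp: adj_def)
  have D1: "fwd (f v) (f w')" if vw: "fwd v w" and vw': "fwd v w'" and "fwd (f v) (f w)" for v w w'
  proof (rule ccontr)
    assume "\<not> fwd (f v) (f w')"
    then have b: "fwd (f w') (f v)" using fadj that by blast
    obtain z where z: "z \<noteq> v" "fwd z w" "fwd z w'" by (rule two_outs[OF vw vw'])
    have "f z = f v"
      using fadj[OF z(2)] fadj[OF z(3)] unfolding adj_def[symmetric]
      by (intro in_out_unique[OF that(3) b]) (blast intro: adj_sym)+
    then show False using inj z W that by blast
  qed
  have D2: "fwd (f v) (f w) \<longleftrightarrow> fwd (f w) (f a)" if vw: "fwd v w" and wa: "fwd w a" for v w a
  proof (rule ccontr)
    assume "\<not> ?thesis"
    then consider "fwd (f v) (f w)" "fwd (f a) (f w)" | "fwd (f w) (f v)" "fwd (f w) (f a)"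
      using fadj vw wa by blast
    then obtain z where z: "z \<noteq> f w" "adj (f v) z" "adj (f a) z" "z \<in> pverts (PX n k)"
    proof cases
      case 1
      then show ?thesis using two_ins[OF 1] that W unfolding adj_def by metis
    next
      case 2
      then show ?thesis using two_outs[OF 2] that W unfolding adj_def by metis
    qed
    obtain y where y: "y \<in> pverts (PX n k)" "z = f y" using z(4) bij
      by (metis bij_betw_imp_surj_on imageE)
    have "y = w" using z y W vw wa adj by (intro in_out_unique[OF wa vw]) blast+
    then show False using y z by simp
  qed
  \<comment> \<open>By \<open>D1\<close> a single arc out of \<open>v\<close> decides this, by
    \<open>D2\<close> it passes to the next vertex, and connectedness makes it constant.\<close>
  define P where "P v \<longleftrightarrow> (\<forall>w. fwd v w \<longrightarrow> fwd (f v) (f w))" for v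
  have P: "P v \<longleftrightarrow> fwd (f v) (f w)" if "fwd v w" for v w
    using D1 that unfolding P_def by blast
  have const: "P (vt i u) = P (vt j u')" if "u \<in> V" "u' \<in> V" for i j u u'
  proof (rule vt_invariant_const[where H = "\<lambda>i u. P (vt i u)"])
    fix i u assume u: "u \<in> V"
    show "P (vt (i + 1) u) = P (vt i u)"
      using P[OF fwd_vt[OF u, of i]] P[OF fwd_vt[OF u, of "i + 1"]]
        D2[OF fwd_vt[OF u, of i] fwd_vt[OF u, of "i + 1"]] by simp
  qed (use that in auto)
  have const': "P v = P (vt 0 (\<lambda>_. 0))" if "fwd v w" for v w
    using that const[OF _ V_0] unfolding fwd_def by metis
  show ?thesis
  proof (cases "P (vt 0 (\<lambda>_. 0))")
    case True
    then show ?thesis using P const' by blast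
  next
    case False
    then show ?thesis using P const' fadj by blast
  qed
qed

end

section \<open>Regular groups of automorphisms\<close>

text \<open>On representatives of the cosets of \<open>K\<close>, taking \<open>q\<close> to
  \<open>rep (D q)\<close> is injective by \<open>ker\<close>, hence surjective by
  finiteness.\<close>

lemma subgroup_coset_surj:
  assumes fin: "finite W" and W: "add_subgroup W" and K: "add_subgroup K"
    and D: "\<And>x. x \<in> W \<Longrightarrow> D x \<in> W" "\<And>x y. D (\<lambda>p. x p + y p) = (\<lambda>p. D x p + D y p)"
    and ker: "\<And>x. x \<in> W \<Longrightarrow> D x \<in> K \<Longrightarrow> x \<in> K"
    and d: "d \<in> W"
  shows "\<exists>e\<in>W. (\<lambda>p. d p + D e p) \<in> K"
proof -
  define rep where "rep v = (SOME x. x \<in> W \<and> (\<lambda>p. v p + x p) \<in> K)" for v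
  have add: "(\<lambda>p. x p + y p) \<in> K" if "x \<in> K" "y \<in> K" for x y
    using K that by (simp add: add_subgroup_def)
  have rep: "rep v \<in> W \<and> (\<lambda>p. v p + rep v p) \<in> K" if "v \<in> W" for v
    unfolding rep_def using that K
    by (intro someI[of "\<lambda>x. x \<in> W \<and> (\<lambda>p. v p + x p) \<in> K" v]) (simp add: add_subgroup_def)
  have rep_eq: "rep v = rep v'" if e: "(\<lambda>p. v p + v' p) \<in> K" for v v'
  proof -
    \<comment> \<open>Congruent elements define the same predicate, so the choice operator picks the
      same representative.\<close>
    have "(\<lambda>p. v p + x p) \<in> K \<longleftrightarrow> (\<lambda>p. v' p + x p) \<in> K" for x
      using add[OF e, of "\<lambda>p. v p + x p"] add[OF e, of "\<lambda>p. v' p + x p"] by (auto simp: ac_simps)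
    then show ?thesis by (simp add: rep_def)
  qed
  have idem: "rep (rep v) = rep v" if "v \<in> W" for v
    using rep_eq[of v "rep v"] rep[OF that] by simp
  have "inj_on (\<lambda>q. rep (D q)) (rep ` W)"
  proof (rule inj_onI)
    fix x y assume xy: "x \<in> rep ` W" "y \<in> rep ` W" "rep (D x) = rep (D y)"
    then have W': "x \<in> W" "y \<in> W" using rep by auto
    have "(\<lambda>p. D x p + D y p) \<in> K"
      using add[of "\<lambda>p. D x p + rep (D x) p" "\<lambda>p. D y p + rep (D x) p"] rep[OF D(1)[OF W'(1)]]
        rep[OF D(1)[OF W'(2)]] xy(3) by (simp add: ac_simps)
    moreover have "(\<lambda>p. x p + y p) \<in> W" using W W' by (simp add: add_subgroup_def)
    ultimately have "(\<lambda>p. x p + y p) \<in> K" using ker D(2) by metis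
    then have "rep x = rep y" by (rule rep_eq)
    then show "x = y" using xy idem by auto
  qed
  then have "(\<lambda>q. rep (D q)) ` rep ` W = rep ` W"
    using fin rep D(1) by (intro endo_inj_surj) auto
  then have "rep d \<in> (\<lambda>q. rep (D q)) ` rep ` W" using d by blast
  then obtain e where e: "e \<in> W" "rep d = rep (D e)" using rep by blast
  have "(\<lambda>p. d p + D e p) \<in> K"
    using add[of "\<lambda>p. d p + rep d p" "\<lambda>p. D e p + rep d p"] rep[OF d] rep[OF D(1)[OF e(1)]] e(2)
    by (simp add: ac_simps)
  then show ?thesis using e(1) by blast
qed

text \<open>
  \<open>Rp r c\<close> and \<open>Rm q c\<close> say that the regular group contains the automorphism induced by
  \<open>u \<mapsto> (\<lambda>p. u (p - r) + c p)\<close> and \<open>u \<mapsto> (\<lambda>p. u (q - p) + c p)\<close>, respectively.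
\<close>

locale px_regular = px +
  fixes Rp Rm :: "int \<Rightarrow> (int \<Rightarrow> bit) \<Rightarrow> bool"
  assumes Rp_V: "Rp r c \<Longrightarrow> c \<in> V" and Rm_V: "Rm q c \<Longrightarrow> c \<in> V"
    and PP: "Rp r c \<Longrightarrow> Rp s d \<Longrightarrow> Rp (r + s) (\<lambda>p. c (p - s) + d p)"
    and MP: "Rm q c \<Longrightarrow> Rp s d \<Longrightarrow> Rm (q + s) (\<lambda>p. c (p - s) + d p)"
    and MM: "Rm q c \<Longrightarrow> Rm s d \<Longrightarrow> Rp (s - q) (\<lambda>p. c (s - p) + d p)"
    and P_one: "Rp 0 (\<lambda>_. 0)"
    and P_inv: "Rp r c \<Longrightarrow> Rp (- r) (\<lambda>p. c (p + r))"
    and P_mod: "Rp r c \<Longrightarrow> r mod int n = s mod int n \<Longrightarrow> Rp s c"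
    and M_mod: "Rm q c \<Longrightarrow> q mod int n = s mod int n \<Longrightarrow> Rm s c"
    and trans: "u \<in> V \<Longrightarrow> u' \<in> V \<Longrightarrow>
      (\<exists>r c. Rp r c \<and> vt (i + r) (\<lambda>p. u (p - r) + c p) = vt j u') \<or>
      (\<exists>q c. Rm q c \<and> vt (q - i - int k + 1) (\<lambda>p. u (q - p) + c p) = vt j u')"
    and P_free: "Rp 0 c \<Longrightarrow> u \<in> V \<Longrightarrow> vt i (\<lambda>p. u p + c p) = vt i u \<Longrightarrow> c = (\<lambda>_. 0)"
    and M_free: "Rm q c \<Longrightarrow> u \<in> V \<Longrightarrow> vt (q - i - int k + 1) (\<lambda>p. u (q - p) + c p) \<noteq> vt i u"
begin

section \<open>The translations in a regular group\<close>

definition K :: "(int \<Rightarrow> bit) set" where "K = {c. Rp 0 c}"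

lemma K_V: "K \<subseteq> V" using Rp_V by (auto simp: K_def)

lemma K_add: "c \<in> K \<Longrightarrow> d \<in> K \<Longrightarrow> (\<lambda>p. c p + d p) \<in> K"
  using PP[of 0 c 0 d] by (simp add: K_def)

lemma K_subgroup: "add_subgroup K"
  using P_one K_add by (simp add: add_subgroup_def K_def)

text \<open>Conjugate the translation by the given rotation; the contributions of \<open>d\<close>
  cancel.\<close>

lemma K_shift:
  assumes "Rp r d" "c \<in> K"
  shows "(\<lambda>p. c (p - r)) \<in> K"
  using PP[OF PP[OF P_inv[OF assms(1)], of 0 c] assms(1)] assms(2) by (simp add: K_def)

text \<open>The translation by the sum takes \<open>c\<close> to \<open>d\<close>, so it fixes the
  vertex \<open>vt 0 c\<close>.\<close>

lemma K_free:
  assumes "c \<in> V" "vt 0 c = vt 0 d" "(\<lambda>p. c p + d p) \<in> K"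
  shows "c = d"
proof -
  have "(\<lambda>p. c p + d p) = (\<lambda>_. 0)" using P_free[of "\<lambda>p. c p + d p" c 0] assms by (simp add: K_def)
  then show ?thesis by (simp add: fun_eq_iff bit_add_eq_0_iff)
qed

definition fibre :: "(nat \<times> bit list) set" where "fibre = vt 0 ` V"

lemma card_fibre: "card fibre = 2 ^ k"
proof -
  have "fibre = {0} \<times> {x. length x = k}"
  proof (intro equalityI subsetI)
    fix v assume "v \<in> {0 :: nat} \<times> {x :: bit list. length x = k}"
    then obtain x where x: "v = (0, x)" "length x = k" by auto
    obtain u where u: "u \<in> V" "\<And>j. j < k \<Longrightarrow> u (0 + int j) = x ! j"
      using word_window[of k x 0] x(2) kn by auto
    have "v = vt 0 u" using x u(2) by (intro vt_eqI) auto
    then show "v \<in> fibre" using u(1) by (auto simp: fibre_def)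
  qed (auto simp: fibre_def vt_def)
  then show ?thesis
    using card_lists_length_eq[of "UNIV :: bit set" k]
    by (simp add: finite_UNIV_bit card_UNIV_bit card_cartesian_product_singleton)
qed

lemma level_move:
  "(\<exists>r c. Rp r c \<and> r mod int n = l mod int n) \<or>
   (\<exists>q c. Rm q c \<and> (q - int k + 1) mod int n = l mod int n)"
proof -
  consider r c where "Rp r c" "vt (0 + r) (\<lambda>p. c p) = vt l (\<lambda>_. 0)"
    | q c where "Rm q c" "vt (q - 0 - int k + 1) (\<lambda>p. c p) = vt l (\<lambda>_. 0)"
    using trans[OF V_0 V_0, of 0 l] by auto
  then show ?thesis by cases (auto simp: vt_eq_iff)
qed

text \<open>A reflection with index \<open>q\<close> takes level 0 to \<open>q - k + 1\<close>, so
  those fixing the fibre have index \<open>k - 1\<close> modulo \<open>n\<close>.\<close>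

lemma fibre_move:
  assumes "v \<in> fibre"
  shows "(\<exists>c\<in>K. v = vt 0 c) \<or> (\<exists>c. Rm (int k - 1) c \<and> v = vt 0 c)"
proof -
  obtain u where u: "u \<in> V" "v = vt 0 u" using assms by (auto simp: fibre_def)
  consider r c where "Rp r c" "vt r c = vt 0 u"
    | q c where "Rm q c" "vt (q - int k + 1) c = vt 0 u"
    using trans[OF V_0 u(1), of 0 0] by auto
  then show ?thesis
  proof cases
    case 1
    then have r: "r mod int n = 0 mod int n" by (simp add: vt_eq_iff)
    then have "c \<in> K" using P_mod[OF 1(1) r] by (simp add: K_def)
    moreover have "vt r c = vt 0 c" using 1 r by (intro vt_cong Rp_V)
    ultimately show ?thesis using u 1 by auto
  next
    case 2
    then have q: "(q - int k + 1) mod int n = 0 mod int n" by (simp add: vt_eq_iff)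
    then have "q mod int n = (int k - 1) mod int n"
      unfolding mod_eq_dvd_iff by (simp add: algebra_simps)
    then have "Rm (int k - 1) c" using M_mod[OF 2(1)] by blast
    moreover have "vt (q - int k + 1) c = vt 0 c" using 2 q by (intro vt_cong Rm_V)
    ultimately show ?thesis using u 2 by auto
  qed
qed

text \<open>\<open>K\<close> alone is regular on the fibre. Among the elements taking level 0 to
  levels 1 and 2 there is a rotation, or both are reflections and their product rotates by
  one.\<close>

lemma quasicyclic_code_no_reflection:
  assumes no: "\<And>c. \<not> Rm (int k - 1) c"
  shows "card K = 2 ^ k" and "c \<in> K \<Longrightarrow> (\<lambda>p. c (p - 2)) \<in> K"
proof -
  have "inj_on (vt 0) K" using K_free K_V K_add by (auto intro!: inj_onI)
  moreover have "vt 0 ` K = fibre"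
  proof
    show "vt 0 ` K \<subseteq> fibre" using K_V by (auto simp: fibre_def)
    show "fibre \<subseteq> vt 0 ` K" using fibre_move no by blast
  qed
  ultimately show "card K = 2 ^ k" using card_fibre card_image by metis
next
  assume c: "c \<in> K"
  have one: "(\<lambda>p. c (p - 2)) \<in> K" if "Rp r d" "r mod int n = 1 mod int n" for r d
    using K_shift[OF P_mod[OF that] K_shift[OF P_mod[OF that] c]] by simp
  consider r d where "Rp r d" "r mod int n = 1 mod int n" | r d
    where "Rp r d" "r mod int n = 2 mod int n"
    | q d q' d' where "Rm q d" "(q - int k + 1) mod int n = 1 mod int n"
        "Rm q' d'" "(q' - int k + 1) mod int n = 2 mod int n"
    using level_move[of 1] level_move[of 2] by blast
  then show "(\<lambda>p. c (p - 2)) \<in> K"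
  proof cases
    case 1
    then show ?thesis by (rule one)
  next
    case 2
    then show ?thesis using K_shift[OF P_mod[OF 2] c] by simp
  next
    case 3
    have "(q' - int k + 1 - (q - int k + 1)) mod int n = (2 - 1) mod int n"
      by (rule mod_diff_cong[OF 3(4,2)])
    then show ?thesis using one[OF MM[OF 3(1,3)]] by simp
  qed
qed

text \<open>If level 1 is reached by a reflection, its product with the reflection fixing the fibre
  is a rotation by one.\<close>

lemma rotation_by_one:
  assumes "Rm (int k - 1) c0"
  obtains d where "Rp 1 d"
proof -
  consider r d where "Rp r d" "r mod int n = 1 mod int n"
    | q d where "Rm q d" "(q - int k + 1) mod int n = 1 mod int n" using level_move[of 1] by blast
  then show ?thesis
  proof cases
    case 1
    then show ?thesis using P_mod that by blast
  next
    case 2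
    then have "Rp (q - (int k - 1)) (\<lambda>p. c0 (q - p) + d p)" using MM assms by blast
    then have "Rp 1 (\<lambda>p. c0 (q - p) + d p)"
      by (rule P_mod) (use 2(2) in \<open>simp add: algebra_simps\<close>)
    then show ?thesis by (rule that)
  qed
qed

text \<open>The stabiliser of the fibre consists of \<open>K\<close> and the coset \<open>L\<close>
  of reflections, and it is regular on the fibre.\<close>

lemma card_K_reflection:
  assumes c0: "Rm (int k - 1) c0"
  shows "2 * card K = 2 ^ k"
proof -
  define L where "L = (\<lambda>c p. c0 p + c p) ` K"
  have L: "Rm (int k - 1) x" if "x \<in> L" for x
    using that MP[OF c0, of 0] by (auto simp: L_def K_def)
  have LI: "c \<in> L" if c: "Rm (int k - 1) c" for c
  proof -
    \<comment> \<open>The products of \<open>c0\<close> with itself and with \<open>c\<close> are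
      translations; their reflected terms cancel in the sum.\<close>
    have "(\<lambda>p. c0 p + c p) \<in> K"
      using K_add[of "\<lambda>p. c0 (int k - 1 - p) + c0 p" "\<lambda>p. c0 (int k - 1 - p) + c p"]
        MM[OF c0 c0] MM[OF c0 c] by (simp add: K_def ac_simps)
    then show ?thesis unfolding L_def by (intro image_eqI[of _ _ "\<lambda>p. c0 p + c p"]) simp_all
  qed
  have KL: "vt 0 x \<noteq> vt 0 y" if xy: "x \<in> K" "y \<in> L" for x y
  proof
    assume e: "vt 0 x = vt 0 y"
    \<comment> \<open>Were the windows equal, this reflection would fix the zero vertex of the
      fibre.\<close>
    have "Rm (int k - 1) (\<lambda>p. y p + x p)" using MP[OF L[OF xy(2)], of 0 x] xy(1)
      by (simp add: K_def)
    from M_free[OF this V_0, of 0] have "vt 0 (\<lambda>p. y p + x p) \<noteq> vt 0 (\<lambda>_. 0)" by simp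
    moreover have "vt 0 (\<lambda>p. y p + x p) = vt 0 (\<lambda>_. 0)"
      using e by (simp add: vt_window_iff)
    ultimately show False by simp
  qed
  have LL: "(\<lambda>p. x p + y p) \<in> K" if xy: "x \<in> L" "y \<in> L" for x y
    using xy K_add by (auto simp: L_def ac_simps)
  have LV: "L \<subseteq> V" using L Rm_V by blast
  have "inj_on (vt 0) (K \<union> L)"
  proof (rule inj_onI)
    fix x y assume xy: "x \<in> K \<union> L" "y \<in> K \<union> L" "vt 0 x = vt 0 y"
    then have "(\<lambda>p. x p + y p) \<in> K" using KL[of x y] KL[of y x] LL K_add by auto
    then show "x = y" using K_free[OF _ xy(3)] xy(1) K_V LV by blast
  qed
  moreover have "vt 0 ` (K \<union> L) = fibre"
  proof
    show "vt 0 ` (K \<union> L) \<subseteq> fibre" using K_V LV by (auto simp: fibre_def)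
    show "fibre \<subseteq> vt 0 ` (K \<union> L)" using fibre_move LI by blast
  qed
  ultimately have "card (K \<union> L) = 2 ^ k" using card_fibre card_image by metis
  moreover have "card L = card K" unfolding L_def
    by (rule card_image) (auto intro!: inj_onI simp: fun_eq_iff)
  moreover have "finite K" "finite L" "K \<inter> L = {}"
    using finite_subset[OF _ finite_cyclic_seqs[OF n_pos]] K_V LV KL by blast+
  ultimately show ?thesis by (simp add: card_Un_disjoint)
qed

text \<open>
  If \<open>1 + S\<close>, with \<open>S\<close> the shift, were injective modulo \<open>K\<close>, then it would be surjective modulo \<open>K\<close>,
  so the rotation would fix a point \<open>e\<close> modulo \<open>K\<close>. Its image under the reflection is fixed by the
  conjugate rotation, and the difference of the two points is then a shift-invariant class.
\<close>

lemma shift_invariant_class: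
  assumes c0: "Rm (int k - 1) c0" and d: "Rp 1 d"
  obtains w where "w \<in> V" "w \<notin> K" "(\<lambda>p. w p + w (p - 1)) \<in> K"
proof (rule ccontr)
  note ex = that
  assume nt: "\<not> thesis"
  have no: "w \<in> K" if "w \<in> V" "(\<lambda>p. w p + w (p - 1)) \<in> K" for w
    using ex[of w] nt that by blast
  define q where "q = int k - 1"
  have c0V: "c0 \<in> V" and dV: "d \<in> V" using c0 d Rm_V Rp_V by auto
  have Vsub: "add_subgroup V" by (simp add: add_subgroup_def V_add)
  have "\<exists>e\<in>V. (\<lambda>p. d p + (e p + e (p - 1))) \<in> K"
    by (rule subgroup_coset_surj[where D
      = "\<lambda>x p. x p + x (p - 1)", OF finite_cyclic_seqs[OF n_pos] Vsub K_subgroup _ _ no dV])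
      (simp_all add: V_add V_shift fun_eq_iff ac_simps)
  then obtain e where e: "e \<in> V" "(\<lambda>p. d p + (e p + e (p - 1))) \<in> K" by blast
  \<comment> \<open>Correcting the rotation by an element of \<open>K\<close> makes it fix
    \<open>e\<close> exactly.\<close>
  have \<rho>: "Rp 1 (\<lambda>p. e p + e (p - 1))"
    using PP[OF d, of 0 "\<lambda>p. d p + (e p + e (p - 1))"] e(2) by (simp add: K_def)
  have \<sigma>: "Rm q c0" using c0 by (simp add: q_def)
  \<comment> \<open>The difference of \<open>e\<close> and its image under the reflection
    \<open>\<sigma>\<close>. Were it in \<open>K\<close>, a corrected reflection would fix
    \<open>e\<close>.\<close>
  define w where "w = (\<lambda>p. c0 p + (e p + e (q - p)))"
  have wV: "w \<in> V" unfolding w_def using c0V e(1) by (intro V_add V_reflect)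
  have "w \<notin> K"
  proof
    assume "w \<in> K"
    then have "Rm q (\<lambda>p. c0 p + w p)" using MP[OF \<sigma>, of 0 w] by (simp add: K_def)
    from M_free[OF this e(1), of 0] show False by (simp add: w_def q_def ac_simps)
  qed
  moreover have "(\<lambda>p. w p + w (p - 1)) \<in> K"
  proof -
    \<comment> \<open>The words \<open>\<sigma>\<sigma>\<close> and
      \<open>\<sigma>\<rho>\<sigma>\<rho>\<close> are translations; they add up to \<open>w\<close>
      plus its shift.\<close>
    have 1: "(\<lambda>p. c0 (q - p) + c0 p) \<in> K" using MM[OF \<sigma> \<sigma>] by (simp add: K_def)
    have 2: "(\<lambda>p. c0 (q - (p - 1) - 1) + (e (q - (p - 1)) + e (q - (p - 1) - 1)) + c0 (p - 1)
        + (e p + e (p - 1))) \<in> K"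
      using PP[OF MM[OF MP[OF \<sigma> \<rho>] \<sigma>] \<rho>] by (simp add: K_def)
    from K_add[OF 1 2] show ?thesis by (simp add: w_def algebra_simps)
  qed
  ultimately show False using no wV by blast
qed

text \<open>In the presence of a reflection fixing the fibre, \<open>K\<close> has half the required
  size; adjoining the coset of a shift-invariant class doubles it and keeps invariance under the
  rotation by one.\<close>

lemma quasicyclic_code:
  obtains C where "C \<subseteq> V" "add_subgroup C" "card C = 2 ^ k" "\<And>c. c \<in> C \<Longrightarrow> (\<lambda>p. c (p - 2)) \<in> C"
proof (cases "\<exists>c. Rm (int k - 1) c")
  case False
  then show ?thesis using that[of K] K_V K_subgroup quasicyclic_code_no_reflection by blast
next
  case True
  then obtain c0 where c0: "Rm (int k - 1) c0" by blast
  obtain d where d: "Rp 1 d" using rotation_by_one[OF c0] by blast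
  obtain w where w: "w \<in> V" "w \<notin> K" "(\<lambda>p. w p + w (p - 1)) \<in> K"
    using shift_invariant_class[OF c0 d] by blast
  let ?L = "(\<lambda>c p. w p + c p) ` K"
  have fin: "finite K" using finite_subset[OF K_V finite_cyclic_seqs[OF n_pos]] .
  have "K \<inter> ?L = {}"
  proof (rule ccontr)
    assume "K \<inter> ?L \<noteq> {}"
    then obtain c where c: "c \<in> K" "(\<lambda>p. w p + c p) \<in> K" by blast
    then have "w \<in> K" using K_add[OF c] by (simp add: ac_simps)
    then show False using w(2) by simp
  qed
  moreover have "card ?L = card K" by (rule card_image) (auto intro!: inj_onI simp: fun_eq_iff)
  ultimately have card: "card (K \<union> ?L) = 2 ^ k"
    using fin card_K_reflection[OF c0] by (simp add: card_Un_disjoint)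
  have mem: "x \<in> K \<union> ?L \<longleftrightarrow> x \<in> K \<or> (\<lambda>p. w p + x p) \<in> K" for x
  proof -
    have "x \<in> ?L \<longleftrightarrow> (\<lambda>p. w p + x p) \<in> K"
      by (auto intro!: image_eqI[of x _ "\<lambda>p. w p + x p"])
    then show ?thesis by blast
  qed
  have "add_subgroup (K \<union> ?L)"
    unfolding add_subgroup_def mem
  proof (intro conjI ballI)
    show "(\<lambda>_. 0) \<in> K \<or> (\<lambda>p. w p + 0) \<in> K" using P_one by (simp add: K_def)
    fix x y assume "x \<in> K \<union> ?L" "y \<in> K \<union> ?L"
    then consider "x \<in> K" "y \<in> K" | "x \<in> K" "(\<lambda>p. w p + y p) \<in> K"
      | "(\<lambda>p. w p + x p) \<in> K" "y \<in> K" | "(\<lambda>p. w p + x p) \<in> K" "(\<lambda>p. w p + y p) \<in> K"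
      unfolding mem by blast
    then show "(\<lambda>p. x p + y p) \<in> K \<or> (\<lambda>p. w p + (x p + y p)) \<in> K"
      by cases (drule (1) K_add, simp add: ac_simps)+
  qed
  moreover have sh: "(\<lambda>p. x (p - 1)) \<in> K \<union> ?L" if "x \<in> K \<union> ?L" for x
  proof -
    consider "x \<in> K" | "(\<lambda>p. w p + x p) \<in> K" using \<open>x \<in> K \<union> ?L\<close> unfolding mem by blast
    then show ?thesis
    proof cases
      case 1
      then show ?thesis using K_shift[OF d] by blast
    next
      case 2
      have "(\<lambda>p. w p + x (p - 1)) \<in> K"
        using K_add[OF K_shift[OF d 2] w(3)] by (simp add: ac_simps)
      then show ?thesis unfolding mem by blast
    qed
  qed
  moreover have "(\<lambda>p. x (p - 2)) \<in> K \<union> ?L" if "x \<in> K \<union> ?L" for x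
    using sh[OF sh[OF that]] by simp
  moreover have "?L \<subseteq> V" using w(1) K_V by (auto intro!: V_add)
  ultimately show ?thesis using that[of "K \<union> ?L"] K_V card by blast
qed

end

section \<open>From a Cayley graph to a divisor\<close>

context px_rigid
begin

lemma divisor_if_cayley:
  assumes "cayley_graph (PX n k)"
  shows "\<exists>g. g dvd cyc_poly n \<and> degree g = n - k"
proof -
  let ?W = "pverts (PX n k)"
  obtain G :: "(nat \<times> bit list) monoid" and S where G: "group G"
    and iso: "digraph_iso (with_proj (PX n k)) (with_proj (Cay G S))"
    using assms unfolding cayley_graph_def by blast
  interpret G: group G by (rule G)
  obtain \<phi> where bij: "bij_betw \<phi> ?W (carrier G)"
    and e: "\<And>v w. v \<in> ?W \<Longrightarrow> w \<in> ?W \<Longrightarrow> (v, w) \<in> parcs (PX n k) \<longleftrightarrow> (\<phi> v, \<phi> w) \<in> parcs (Cay G S)"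
    using iso unfolding digraph_iso_with_proj_iff[OF wf_PX pair_wf_digraph_Cay]
      by (auto simp: Cay_def)
  have \<phi>G: "\<phi> v \<in> carrier G" if "v \<in> ?W" for v using bij that by (auto simp: bij_betw_def)
  have \<phi>inj: "v = w" if "\<phi> v = \<phi> w" "v \<in> ?W" "w \<in> ?W" for v w
    using bij that by (auto simp: bij_betw_def dest: inj_onD)
  have e': "adj v w \<longleftrightarrow> \<phi> w \<otimes>\<^bsub>G\<^esub> inv\<^bsub>G\<^esub> \<phi> v \<in> S" if "v \<in> ?W" "w \<in> ?W" for v w
    using e[OF that] \<phi>G that by (simp add: parcs_PX adj_def Cay_def)
  \<comment> \<open>Right multiplication transported to the vertices; it preserves adjacency because
    \<open>h\<close> times the inverse of \<open>g\<close> is unchanged when both are multiplied on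
    the right.\<close>
  define \<alpha> where "\<alpha> g v = the_inv_into ?W \<phi> (\<phi> v \<otimes>\<^bsub>G\<^esub> g)" for g v
  have \<alpha>: "\<alpha> g v \<in> ?W" "\<phi> (\<alpha> g v) = \<phi> v \<otimes>\<^bsub>G\<^esub> g" if "g \<in> carrier G" "v \<in> ?W" for g v
  proof -
    have "\<phi> v \<otimes>\<^bsub>G\<^esub> g \<in> \<phi> ` ?W" using bij \<phi>G that by (simp add: bij_betw_def)
    then show "\<alpha> g v \<in> ?W" "\<phi> (\<alpha> g v) = \<phi> v \<otimes>\<^bsub>G\<^esub> g"
      using bij unfolding \<alpha>_def bij_betw_def
      by (auto intro: the_inv_into_into f_the_inv_into_f)
  qed
  have \<alpha>mult: "\<alpha> h (\<alpha> g v) = \<alpha> (g \<otimes>\<^bsub>G\<^esub> h) v" if "g \<in> carrier G" "h \<in> carrier G" "v \<in> ?W" for g h v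
    by (rule \<phi>inj) (use that \<alpha> \<phi>G G.m_assoc in simp_all)
  have \<alpha>one: "\<alpha> \<one>\<^bsub>G\<^esub> v = v" if "v \<in> ?W" for v
    by (rule \<phi>inj) (use that \<alpha> \<phi>G in simp_all)
  have free: "g = \<one>\<^bsub>G\<^esub>" if "g \<in> carrier G" "v \<in> ?W" "\<alpha> g v = v" for g v
    using \<alpha>(2)[OF that(1,2)] that \<phi>G[OF that(2)] by simp
  have \<alpha>inv: "\<alpha> (inv\<^bsub>G\<^esub> g) (\<alpha> g v) = v" "\<alpha> g (\<alpha> (inv\<^bsub>G\<^esub> g) v) = v"
    if "g \<in> carrier G" "v \<in> ?W" for g v
    using that by (simp_all add: \<alpha>mult \<alpha>one)
  have \<alpha>bij: "bij_betw (\<alpha> g) ?W ?W" if "g \<in> carrier G" for g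
    by (rule bij_betwI[where g = "\<alpha> (inv\<^bsub>G\<^esub> g)"]) (use that \<alpha> \<alpha>inv in auto)
  have \<alpha>adj: "adj v w \<longleftrightarrow> adj (\<alpha> g v) (\<alpha> g w)" if "g \<in> carrier G" "v \<in> ?W" "w \<in> ?W" for g v w
  proof -
    have "\<phi> w \<otimes>\<^bsub>G\<^esub> g \<otimes>\<^bsub>G\<^esub> inv\<^bsub>G\<^esub> (\<phi> v \<otimes>\<^bsub>G\<^esub> g) = \<phi> w \<otimes>\<^bsub>G\<^esub> inv\<^bsub>G\<^esub> \<phi> v"
      using that \<phi>G by (simp add: G.inv_mult_group G.m_assoc flip: G.m_assoc[of g])
    then show ?thesis using that \<alpha> by (simp add: e')
  qed
  have W: "vt i u \<in> ?W" if "u \<in> V" for i u using that by (auto simp: pverts_PX)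
  define P where "P g r c \<longleftrightarrow> (\<forall>i. \<forall>u\<in>V. \<alpha> g (vt i u) = vt (i + r) (\<lambda>p. u (p - r) + c p))" for g r c
  define M where "M g q c \<longleftrightarrow> (\<forall>i. \<forall>u\<in>V. \<alpha> g (vt i u)
    = vt (q - i - int k + 1) (\<lambda>p. u (q - p) + c p))" for g q c
  have PM: "(\<exists>r. \<exists>c\<in>V. P g r c) \<or> (\<exists>q. \<exists>c\<in>V. M g q c)" if g: "g \<in> carrier G" for g
  proof -
    have inj: "vt i u = vt j u'" if "u \<in> V" "u' \<in> V" "\<alpha> g (vt i u) = \<alpha> g (vt j u')" for i j u u'
      using \<alpha>bij[OF g] that W by (meson bij_betw_def inj_onD)
    have im: "\<exists>j w. \<alpha> g (vt i u) = vt j w" if "u \<in> V" for i u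
      using \<alpha>(1)[OF g W[OF that, of i]] unfolding pverts_PX by blast
    show ?thesis
      using fwd_dichotomy[OF \<alpha>adj[OF g] \<alpha>bij[OF g]] fwd_preserving_form[of "\<alpha> g", OF _ inj im]
        fwd_reversing_form[of "\<alpha> g", OF _ inj im] unfolding P_def M_def by blast
  qed
  define Rp where "Rp r c \<longleftrightarrow> c \<in> V \<and> (\<exists>g\<in>carrier G. P g r c)" for r c
  define Rm where "Rm q c \<longleftrightarrow> c \<in> V \<and> (\<exists>g\<in>carrier G. M g q c)" for q c
  have PD: "\<alpha> g (vt i u) = vt (i + r) (\<lambda>p. u (p - r) + c p)" if "P g r c" "u \<in> V" for g r c i u
    using that by (auto simp: P_def)
  have MD: "\<alpha> g (vt i u) = vt (q - i - int k + 1) (\<lambda>p. u (q - p) + c p)"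
    if "M g q c" "u \<in> V" for g q c i u
    using that by (auto simp: M_def)
  interpret px_regular n k Rp Rm
  proof
    show "Rp r c \<Longrightarrow> c \<in> V" "Rm r c \<Longrightarrow> c \<in> V" for r c by (simp_all add: Rp_def Rm_def)
  next
    fix r c s d assume "Rp r c" "Rp s d"
    then obtain g h where g: "g \<in> carrier G" "P g r c" "c \<in> V"
      and h: "h \<in> carrier G" "P h s d" "d \<in> V"
      by (auto simp: Rp_def)
    have "\<alpha> (g \<otimes>\<^bsub>G\<^esub> h) (vt i u) = vt (i + (r + s)) (\<lambda>p. u (p - (r + s)) + (c (p - s) + d p))"
      if u: "u \<in> V" for i u
    proof -
      have "(\<lambda>p. u (p - r) + c p) \<in> V" using u g(3) by (intro V_add V_shift)
      then show ?thesis using PD[OF g(2) u, of i] PD[OF h(2), of "\<lambda>p. u (p - r) + c p" "i + r"]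
        \<alpha>mult[OF g(1) h(1) W[OF u], of i] by (simp add: algebra_simps)
    qed
    then show "Rp (r + s) (\<lambda>p. c (p - s) + d p)"
      unfolding Rp_def P_def using g h
        by (intro conjI bexI[of _ "g \<otimes>\<^bsub>G\<^esub> h"]) (simp_all add: V_add V_shift)
  next
    fix r c s d assume "Rm r c" "Rp s d"
    then obtain g h where g: "g \<in> carrier G" "M g r c" "c \<in> V"
      and h: "h \<in> carrier G" "P h s d" "d \<in> V"
      by (auto simp: Rp_def Rm_def)
    have "\<alpha> (g \<otimes>\<^bsub>G\<^esub> h) (vt i u)
      = vt (r + s - i - int k + 1) (\<lambda>p. u (r + s - p) + (c (p - s) + d p))" if u: "u \<in> V" for i u
    proof -
      have "(\<lambda>p. u (r - p) + c p) \<in> V" using u g(3) by (intro V_add V_reflect)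
      then show ?thesis using MD[OF g(2) u, of i] PD[OF h(2), of "\<lambda>p. u (r - p) + c p" "r - i - int
        k + 1"]
        \<alpha>mult[OF g(1) h(1) W[OF u], of i] by (simp add: algebra_simps)
    qed
    then show "Rm (r + s) (\<lambda>p. c (p - s) + d p)"
      unfolding Rm_def M_def using g h
        by (intro conjI bexI[of _ "g \<otimes>\<^bsub>G\<^esub> h"]) (simp_all add: V_add V_shift)
  next
    fix r c s d assume "Rm r c" "Rm s d"
    then obtain g h where g: "g \<in> carrier G" "M g r c" "c \<in> V"
      and h: "h \<in> carrier G" "M h s d" "d \<in> V"
      by (auto simp: Rm_def)
    have "\<alpha> (g \<otimes>\<^bsub>G\<^esub> h) (vt i u) = vt (i + (s - r)) (\<lambda>p. u (p - (s - r)) + (c (s - p) + d p))"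
      if u: "u \<in> V" for i u
    proof -
      have "(\<lambda>p. u (r - p) + c p) \<in> V" using u g(3) by (intro V_add V_reflect)
      then show ?thesis using MD[OF g(2) u, of i] MD[OF h(2), of "\<lambda>p. u (r - p) + c p" "r - i - int
        k + 1"]
        \<alpha>mult[OF g(1) h(1) W[OF u], of i] by (simp add: algebra_simps)
    qed
    then show "Rp (s - r) (\<lambda>p. c (s - p) + d p)"
      unfolding Rp_def P_def using g h
        by (intro conjI bexI[of _ "g \<otimes>\<^bsub>G\<^esub> h"]) (simp_all add: V_add V_reflect)
  next
    show "Rp 0 (\<lambda>_. 0)"
      unfolding Rp_def P_def using \<alpha>one W by (intro conjI bexI[of _ "\<one>\<^bsub>G\<^esub>"]) simp_all
  next
    fix r c assume "Rp r c"
    then obtain g where g: "g \<in> carrier G" "P g r c" "c \<in> V" by (auto simp: Rp_def)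
    have c': "(\<lambda>p. c (p + r)) \<in> V" using V_shift[OF g(3), of "- r"] by simp
    have "\<alpha> (inv\<^bsub>G\<^esub> g) (vt i u) = vt (i + - r) (\<lambda>p. u (p - - r) + c (p + r))" if u: "u \<in> V" for i u
    proof -
      have u': "(\<lambda>p. u (p + r) + c (p + r)) \<in> V" using V_shift[OF u, of "- r"] c'
        by (simp add: V_add)
      have "\<alpha> g (vt (i - r) (\<lambda>p. u (p + r) + c (p + r))) = vt i u"
        using PD[OF g(2) u', of "i - r"] by (simp add: ac_simps)
      then show ?thesis using \<alpha>inv(1)[OF g(1) W[OF u'], of "i - r"] by simp
    qed
    then show "Rp (- r) (\<lambda>p. c (p + r))"
      unfolding Rp_def P_def using g(1) c' by (intro conjI bexI[of _ "inv\<^bsub>G\<^esub> g"]) simp_all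
  next
    fix r s c assume "Rp r c" and rs: "r mod int n = s mod int n"
    then obtain g where g: "g \<in> carrier G" "P g r c" "c \<in> V" by (auto simp: Rp_def)
    have "vt (i + r) (\<lambda>p. u (p - r) + c p) = vt (i + s) (\<lambda>p. u (p - s) + c p)" if u: "u \<in> V" for i u
    proof -
      have "u (p - r) = u (p - s)" for p using rs by (intro V_cong[OF u] mod_diff_cong) simp_all
      moreover have "vt (i + r) (\<lambda>p. u (p - s) + c p) = vt (i + s) (\<lambda>p. u (p - s) + c p)"
        using rs u g(3) by (intro vt_cong mod_add_cong V_add V_shift) simp_all
      ultimately show ?thesis by simp
    qed
    then show "Rp s c" using g unfolding Rp_def P_def by auto
  next
    fix r s c assume "Rm r c" and rs: "r mod int n = s mod int n"
    then obtain g where g: "g \<in> carrier G" "M g r c" "c \<in> V" by (auto simp: Rm_def)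
    have "vt (r - i - int k + 1) (\<lambda>p. u (r - p) + c p)
      = vt (s - i - int k + 1) (\<lambda>p. u (s - p) + c p)" if u: "u \<in> V" for i u
    proof -
      have "u (r - p) = u (s - p)" for p using rs by (intro V_cong[OF u] mod_diff_cong) simp_all
      moreover have "vt (r - i - int k + 1) (\<lambda>p. u (s - p) + c p)
        = vt (s - i - int k + 1) (\<lambda>p. u (s - p) + c p)"
        using rs u g(3) by (intro vt_cong mod_add_cong mod_diff_cong V_add V_reflect) simp_all
      ultimately show ?thesis by simp
    qed
    then show "Rm s c" using g unfolding Rm_def M_def by auto
  next
    fix u u' i j assume u: "u \<in> V" "u' \<in> V"
    \<comment> \<open>The unique group element whose right multiplication takes the first vertex to
      the second.\<close>
    define g where "g = inv\<^bsub>G\<^esub> (\<phi> (vt i u)) \<otimes>\<^bsub>G\<^esub> \<phi> (vt j u')"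
    have g: "g \<in> carrier G" using u W \<phi>G by (simp add: g_def)
    have "\<phi> (vt i u) \<otimes>\<^bsub>G\<^esub> g = \<phi> (vt j u')" using u W \<phi>G by (simp add: g_def flip: G.m_assoc)
    then have "\<alpha> g (vt i u) = vt j u'"
      using \<alpha>[OF g W[OF u(1), of i]] W[OF u(2)] by (simp add: \<phi>inj)
    then show "(\<exists>r c. Rp r c \<and> vt (i + r) (\<lambda>p. u (p - r) + c p) = vt j u') \<or>
        (\<exists>q c. Rm q c \<and> vt (q - i - int k + 1) (\<lambda>p. u (q - p) + c p) = vt j u')"
      using PM[OF g] PD[OF _ u(1), of g _ _ i] MD[OF _ u(1), of g _ _ i] g
        unfolding Rp_def Rm_def by metis
  next
    fix c u i assume "Rp 0 c" and u: "u \<in> V" and fx: "vt i (\<lambda>p. u p + c p) = vt i u"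
    then obtain g where g: "g \<in> carrier G" "P g 0 c" by (auto simp: Rp_def)
    have "g = \<one>\<^bsub>G\<^esub>" using free[OF g(1) W[OF u, of i]] PD[OF g(2) u, of i] fx by simp
    then have z: "vt p c = vt p (\<lambda>_. 0)" for p using PD[OF g(2) V_0, of p] \<alpha>one[OF W[OF V_0]]
      by simp
    \<comment> \<open>Every position is the first one of some window, and windows are nonempty as
      \<open>k \<ge> 1\<close>.\<close>
    have "c p = 0" for p using z[of p, unfolded vt_window_iff, rule_format, of p] k1 by simp
    then show "c = (\<lambda>_. 0)" by (simp add: fun_eq_iff)
  next
    fix q c u i assume "Rm q c" and u: "u \<in> V"
    then obtain g where g: "g \<in> carrier G" "M g q c" by (auto simp: Rm_def)
    show "vt (q - i - int k + 1) (\<lambda>p. u (q - p) + c p) \<noteq> vt i u"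
    proof
      assume "vt (q - i - int k + 1) (\<lambda>p. u (q - p) + c p) = vt i u"
      then have "g = \<one>\<^bsub>G\<^esub>" using free[OF g(1) W[OF u, of i]] MD[OF g(2) u, of i] by simp
      \<comment> \<open>The identity fixes all levels, but a reflection reverses them; levels 0 and
        1 already force \<open>n\<close> to divide 2.\<close>
      then have "(q - j - int k + 1) mod int n = j mod int n" for j
        using MD[OF g(2) V_0, of j] \<alpha>one[OF W[OF V_0]] by (simp add: vt_eq_iff)
      then have dv: "int n dvd q - j - int k + 1 - j" for j by (rule mod_eq_dvd_iff[THEN iffD1])
      have "int n dvd 2" using dvd_diff[OF dv[of 0] dv[of 1]] by simp
      then show False using n3 zdvd_imp_le[of "int n" 2] by simp
    qed
  qed
  obtain C where "C \<subseteq> V" "add_subgroup C" "card C = 2 ^ k" "\<And>c. c \<in> C \<Longrightarrow> (\<lambda>p. c (p - 2)) \<in> C"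
    using quasicyclic_code by blast
  then show ?thesis using quasicyclic_code_divisor[OF n_pos] by blast
qed

end

theorem theorem1:
  fixes n k :: nat
  assumes "n \<ge> 3" and "1 \<le> k" and "k \<le> n - 1"
  shows "cayley_graph (PX n k) \<longleftrightarrow>
    (\<exists>p :: bit poly. p dvd monom 1 n + 1 \<and> degree p = n - k)"
proof -
  interpret px n k using assms by unfold_locales auto
  have "\<exists>g. g dvd cyc_poly n \<and> degree g = n - k" if c: "cayley_graph (PX n k)"
  proof -
    consider "k = 1" | "n = 4" | "k \<ge> 2" "n \<noteq> 4" using k1 by linarith
    then show ?thesis
    proof cases
      case 1
      then show ?thesis using cyc_poly_divisor_1[OF n_pos] by simp
    next
      case 2
      then show ?thesis using cyc_poly_divisor_4[of k] kn by simp
    next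
      case 3
      then interpret px_rigid n k by unfold_locales
      show ?thesis using c by (rule divisor_if_cayley)
    qed
  qed
  then show ?thesis using cayley_if_divisor unfolding cyc_poly_def by blast
qed

end
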